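(* Let $\varphi\colon\mathbb{D}\to\mathbb{D}$ be an analytic map. Then $C_\varphi$ is compact on $\mathit{BMOA}$ if and only if $\displaystyle\lim_{|a|\to1}|\sigma_a\circ\varphi|_*=0$.
   Context: $\mathbb{D}$ is the open unit disc, $\|\cdot\|_{H^2}$ the standard Hardy space norm, $\sigma_a(z)=(a-z)/(1-\bar a z)$ for $a\in\mathbb{D}$. $|f|_*=\sup_{a\in\mathbb{D}}\|f\circ\sigma_a-f(a)\|_{H^2}$ for analytic $f\colon\mathbb{D}\to\mathbb{C}$; $\mathit{BMOA}$ is the Banach space of those $f$ with $|f|_*<\infty$, normed by $\|f\|_*=|f(0)|+|f|_*$. $C_\varphi f=f\circ\varphi$; it is always bounded on $\mathit{BMOA}$. *)

theory Defs
  imports "HOL-Complex_Analysis.Complex_Analysis"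
begin

text \<open>
  Norms that may be infinite take values in \<^typ>\<open>ennreal\<close>, so that no supremum has a junk value.
\<close>

abbreviation unit_disc :: "complex set" (\<open>\<bbbD>\<close>)
  where "\<bbbD> \<equiv> ball 0 1"

definition H2_mean :: "(complex \<Rightarrow> complex) \<Rightarrow> real \<Rightarrow> real"
  where "H2_mean f r =
    sqrt (1 / (2 * pi) * integral {0..2 * pi} (\<lambda>t. (cmod (f (complex_of_real r * cis t)))\<^sup>2))"

definition H2_norm :: "(complex \<Rightarrow> complex) \<Rightarrow> ennreal"
  where "H2_norm f = (SUP r\<in>{0..<1}. ennreal (H2_mean f r))"

definition disc_aut :: "complex \<Rightarrow> complex \<Rightarrow> complex" (\<open>\<sigma>\<close>)
  where "\<sigma> a z = (a - z) / (1 - cnj a * z)"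

definition bmoa_seminorm :: "(complex \<Rightarrow> complex) \<Rightarrow> ennreal"
  where "bmoa_seminorm f = (SUP a\<in>\<bbbD>. H2_norm (\<lambda>z. f (\<sigma> a z) - f a))"

text \<open>
  A function on the disc is represented by the function on \<^typ>\<open>complex\<close> that is
  \<^const>\<open>undefined\<close> off the disc, so that equality in \<open>BMOA\<close> is equality on the disc.
\<close>

definition BMOA :: "(complex \<Rightarrow> complex) set"
  where "BMOA = {f \<in> extensional \<bbbD>. f holomorphic_on \<bbbD> \<and> bmoa_seminorm f < \<infinity>}"

definition bmoa_norm :: "(complex \<Rightarrow> complex) \<Rightarrow> real"
  where "bmoa_norm f = cmod (f 0) + enn2real (bmoa_seminorm f)"

definition bmoa_dist :: "(complex \<Rightarrow> complex) \<Rightarrow> (complex \<Rightarrow> complex) \<Rightarrow> real"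
  where "bmoa_dist f g = bmoa_norm (\<lambda>z. f z - g z)"

definition composition_op :: "(complex \<Rightarrow> complex) \<Rightarrow> (complex \<Rightarrow> complex) \<Rightarrow> complex \<Rightarrow> complex"
  where "composition_op \<phi> f = restrict (f \<circ> \<phi>) \<bbbD>"

lemma disc_aut_Moebius: "\<sigma> a z = - Moebius_function 0 a z"
  by (simp add: disc_aut_def Moebius_function_simple minus_divide_left)

lemma disc_aut_in_disc: "a \<in> \<bbbD> \<Longrightarrow> z \<in> \<bbbD> \<Longrightarrow> \<sigma> a z \<in> \<bbbD>"
  using Moebius_function_norm_lt_1[of a z 0] by (simp add: disc_aut_Moebius)

lemma disc_aut_holomorphic: "a \<in> \<bbbD> \<Longrightarrow> \<sigma> a holomorphic_on \<bbbD>"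
proof -
  assume "a \<in> \<bbbD>"
  then have "(\<lambda>z. - Moebius_function 0 a z) holomorphic_on \<bbbD>"
    by (intro holomorphic_intros Moebius_function_holomorphic) simp
  then show ?thesis
    by (simp add: disc_aut_Moebius[abs_def])
qed

lemma circle_in_disc: "r \<in> {0..<1} \<Longrightarrow> complex_of_real r * cis t \<in> \<bbbD>"
  by (simp add: norm_mult)

lemma continuous_on_circle:
  assumes "continuous_on \<bbbD> f" "r \<in> {0..<1}"
  shows "continuous_on S (\<lambda>t. f (complex_of_real r * cis t))"
  by (rule continuous_on_compose2[OF assms(1)])
     (use circle_in_disc[OF assms(2)] in \<open>auto intro!: continuous_intros\<close>)

lemma L2_triangle:
  fixes u v :: "real \<Rightarrow> complex"
  assumes ab: "a < b" and u: "continuous_on {a..b} u" and v: "continuous_on {a..b} v"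
  shows "sqrt (integral {a..b} (\<lambda>t. (cmod (u t + v t))\<^sup>2))
    \<le> sqrt (integral {a..b} (\<lambda>t. (cmod (u t))\<^sup>2)) + sqrt (integral {a..b} (\<lambda>t. (cmod (v t))\<^sup>2))"
proof -
  define A where "A = integral {a..b} (\<lambda>t. (cmod (u t))\<^sup>2)"
  define B where "B = integral {a..b} (\<lambda>t. (cmod (v t))\<^sup>2)"
  have cu: "continuous_on {a..b} (\<lambda>t. (cmod (u t))\<^sup>2)"
    and cv: "continuous_on {a..b} (\<lambda>t. (cmod (v t))\<^sup>2)"
    and cuv: "continuous_on {a..b} (\<lambda>t. (cmod (u t + v t))\<^sup>2)"
    using u v by (auto intro!: continuous_intros)
  note iu = integrable_continuous_real[OF cu] and iv = integrable_continuous_real[OF cv]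
    and iuv = integrable_continuous_real[OF cuv]
  have nn: "A \<ge> 0" "B \<ge> 0"
    unfolding A_def B_def by (auto intro!: integral_nonneg iu iv)
  consider "A = 0" | "B = 0" | "A > 0" "B > 0"
    using nn by linarith
  then show ?thesis
  proof cases
    case 1
    then have "u t = 0" if "t \<in> {a..b}" for t
      using integral_eq_0_iff[OF cu ab] that by (auto simp: A_def)
    then have "integral {a..b} (\<lambda>t. (cmod (u t + v t))\<^sup>2) = B"
      unfolding B_def by (intro integral_cong) auto
    with 1 show ?thesis by (simp add: A_def B_def)
  next
    case 2
    then have "v t = 0" if "t \<in> {a..b}" for t
      using integral_eq_0_iff[OF cv ab] that by (auto simp: B_def)
    then have "integral {a..b} (\<lambda>t. (cmod (u t + v t))\<^sup>2) = A"
      unfolding A_def by (intro integral_cong) auto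
    with 2 show ?thesis by (simp add: A_def B_def)
  next
    case 3
    define c where "c = sqrt B / sqrt A"
    have c: "c > 0" using 3 by (simp add: c_def)
    have pt: "(cmod (u t + v t))\<^sup>2 \<le> (1 + c) * (cmod (u t))\<^sup>2 + (1 + 1 / c) * (cmod (v t))\<^sup>2" for t
    proof -
      define x y where "x = cmod (u t)" and "y = cmod (v t)"
      have "(cmod (u t + v t))\<^sup>2 \<le> (x + y)\<^sup>2"
        unfolding x_def y_def by (intro power_mono norm_triangle_ineq) auto
      also have "\<dots> \<le> (1 + c) * x\<^sup>2 + (1 + 1 / c) * y\<^sup>2"
      proof -
        have "0 \<le> (c * x - y)\<^sup>2 / c" using c by simp
        also have "\<dots> = c * x\<^sup>2 + y\<^sup>2 / c - 2 * x * y"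
          using c by (simp add: field_simps power2_eq_square)
        finally show ?thesis by (simp add: power2_eq_square algebra_simps)
      qed
      finally show ?thesis by (simp add: x_def y_def)
    qed
    have "integral {a..b} (\<lambda>t. (cmod (u t + v t))\<^sup>2)
      \<le> integral {a..b} (\<lambda>t. (1 + c) * (cmod (u t))\<^sup>2 + (1 + 1 / c) * (cmod (v t))\<^sup>2)"
      by (intro integral_le iuv pt integrable_add integrable_on_mult_right iu iv)
    also have "\<dots> = (1 + c) * A + (1 + 1 / c) * B"
      unfolding A_def B_def
      by (subst integral_add) (auto intro!: integrable_on_mult_right iu iv)
    also have "\<dots> = (sqrt A + sqrt B)\<^sup>2"
    proof -
      define p q where "p = sqrt A" and "q = sqrt B"
      have "A = p\<^sup>2" "B = q\<^sup>2" "p > 0" "q > 0" "c = q / p"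
        using 3 by (auto simp: p_def q_def c_def)
      moreover from this have "(1 + c) * p\<^sup>2 = p\<^sup>2 + p * q" "(1 + 1 / c) * q\<^sup>2 = q\<^sup>2 + p * q"
        using c by (simp_all add: field_simps power2_eq_square)
      ultimately show ?thesis
        by (simp add: power2_sum flip: p_def q_def)
    qed
    finally have "sqrt (integral {a..b} (\<lambda>t. (cmod (u t + v t))\<^sup>2)) \<le> sqrt A + sqrt B"
      using nn by (intro real_le_lsqrt) auto
    then show ?thesis by (simp add: A_def B_def)
  qed
qed

lemma H2_mean_triangle:
  assumes "continuous_on \<bbbD> f" "continuous_on \<bbbD> g" "r \<in> {0..<1}"
  shows "H2_mean (\<lambda>z. f z + g z) r \<le> H2_mean f r + H2_mean g r"
  using L2_triangle[of 0 "2 * pi", OF _ continuous_on_circle[OF assms(1,3)]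
      continuous_on_circle[OF assms(2,3)]]
  by (simp add: H2_mean_def real_sqrt_mult real_sqrt_divide divide_right_mono
      flip: add_divide_distrib)

lemma H2_mean_nonneg: "H2_mean f r \<ge> 0"
proof -
  have "integral {0..2 * pi} (\<lambda>t. (cmod (f (complex_of_real r * cis t)))\<^sup>2) \<ge> 0"
    by (cases "(\<lambda>t. (cmod (f (complex_of_real r * cis t)))\<^sup>2) integrable_on {0..2 * pi}")
       (auto intro: integral_nonneg simp: not_integrable_integral)
  then show ?thesis by (simp add: H2_mean_def)
qed

lemma H2_norm_triangle:
  assumes "continuous_on \<bbbD> f" "continuous_on \<bbbD> g"
  shows "H2_norm (\<lambda>z. f z + g z) \<le> H2_norm f + H2_norm g"
proof -
  have "ennreal (H2_mean (\<lambda>z. f z + g z) r) \<le> H2_norm f + H2_norm g" if r: "r \<in> {0..<1}" for r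
  proof -
    have "ennreal (H2_mean (\<lambda>z. f z + g z) r) \<le> ennreal (H2_mean f r) + ennreal (H2_mean g r)"
      using H2_mean_triangle[OF assms r]
      by (simp add: H2_mean_nonneg ennreal_leI flip: ennreal_plus)
    also have "\<dots> \<le> H2_norm f + H2_norm g"
      unfolding H2_norm_def by (intro add_mono SUP_upper r)
    finally show ?thesis .
  qed
  then show ?thesis
    unfolding H2_norm_def[of "\<lambda>z. f z + g z"] by (intro SUP_least)
qed

lemma H2_norm_minus: "H2_norm (\<lambda>z. - f z) = H2_norm f"
  by (simp add: H2_norm_def H2_mean_def)

lemma H2_norm_eq_0D:
  assumes f: "continuous_on \<bbbD> f" and 0: "H2_norm f = 0" and z: "z \<in> \<bbbD>"
  shows "f z = 0"
proof -
  define r where "r = cmod z"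
  have r: "r \<in> {0..<1}" using z by (simp add: r_def)
  define g where "g = (\<lambda>t. (cmod (f (complex_of_real r * cis t)))\<^sup>2)"
  have "ennreal (H2_mean f r) \<le> H2_norm f"
    unfolding H2_norm_def by (intro SUP_upper r)
  then have "H2_mean f r = 0"
    using 0 H2_mean_nonneg[of f r] by simp
  then have "integral {0..2 * pi} g = 0"
    by (simp add: H2_mean_def g_def)
  moreover have "continuous_on {0..2 * pi} g"
    unfolding g_def by (intro continuous_intros continuous_on_circle f r)
  ultimately have "\<forall>t\<in>{0..2 * pi}. g t = 0"
    using integral_eq_0_iff[of 0 "2 * pi" g] by (simp add: g_def)
  then have "g (Arg2pi z) = 0"
    using Arg2pi_ge_0[of z] Arg2pi_lt_2pi[of z] by auto
  moreover have "complex_of_real r * cis (Arg2pi z) = z"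
    using Arg2pi_eq[of z] by (simp add: r_def cis_conv_exp)
  ultimately show ?thesis by (simp add: g_def)
qed

lemma continuous_on_disc_aut_diff:
  assumes "f holomorphic_on \<bbbD>" "a \<in> \<bbbD>"
  shows "continuous_on \<bbbD> (\<lambda>z. f (\<sigma> a z) - f a)"
proof -
  have "(f \<circ> \<sigma> a) holomorphic_on \<bbbD>"
    by (rule holomorphic_on_compose_gen[OF disc_aut_holomorphic[OF assms(2)] assms(1)])
       (use disc_aut_in_disc[OF assms(2)] in blast)
  then have "continuous_on \<bbbD> (\<lambda>z. f (\<sigma> a z))"
    by (simp add: o_def holomorphic_on_imp_continuous_on)
  then show ?thesis by (intro continuous_intros)
qed

lemma bmoa_seminorm_triangle:
  assumes "f holomorphic_on \<bbbD>" "g holomorphic_on \<bbbD>"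
  shows "bmoa_seminorm (\<lambda>z. f z + g z) \<le> bmoa_seminorm f + bmoa_seminorm g"
proof -
  have "H2_norm (\<lambda>z. f (\<sigma> a z) + g (\<sigma> a z) - (f a + g a)) \<le> bmoa_seminorm f + bmoa_seminorm g"
    if a: "a \<in> \<bbbD>" for a
  proof -
    have "H2_norm (\<lambda>z. f (\<sigma> a z) + g (\<sigma> a z) - (f a + g a))
      = H2_norm (\<lambda>z. (f (\<sigma> a z) - f a) + (g (\<sigma> a z) - g a))"
      by (simp add: algebra_simps)
    also have "\<dots> \<le> H2_norm (\<lambda>z. f (\<sigma> a z) - f a) + H2_norm (\<lambda>z. g (\<sigma> a z) - g a)"
      by (intro H2_norm_triangle continuous_on_disc_aut_diff assms a)
    also have "\<dots> \<le> bmoa_seminorm f + bmoa_seminorm g"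
      unfolding bmoa_seminorm_def by (intro add_mono SUP_upper a)
    finally show ?thesis .
  qed
  then show ?thesis
    unfolding bmoa_seminorm_def[of "\<lambda>z. f z + g z"] by (intro SUP_least)
qed

lemma bmoa_seminorm_minus_commute:
  "bmoa_seminorm (\<lambda>z. f z - g z) = bmoa_seminorm (\<lambda>z. g z - f z)"
proof -
  have "H2_norm (\<lambda>z. f (\<sigma> a z) - g (\<sigma> a z) - (f a - g a))
    = H2_norm (\<lambda>z. g (\<sigma> a z) - f (\<sigma> a z) - (g a - f a))" for a
    by (subst H2_norm_minus[symmetric]) (simp add: algebra_simps)
  then show ?thesis by (simp add: bmoa_seminorm_def)
qed

lemma bmoa_seminorm_uminus: "bmoa_seminorm (\<lambda>z. - f z) = bmoa_seminorm f"
  using bmoa_seminorm_minus_commute[of "\<lambda>_. 0" f] by simp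

lemma bmoa_seminorm_diff_finite:
  assumes "f \<in> BMOA" "g \<in> BMOA"
  shows "bmoa_seminorm (\<lambda>z. f z - g z) < \<infinity>"
proof -
  have "bmoa_seminorm (\<lambda>z. f z + - g z) \<le> bmoa_seminorm f + bmoa_seminorm (\<lambda>z. - g z)"
    using assms by (intro bmoa_seminorm_triangle holomorphic_intros) (auto simp: BMOA_def)
  also have "\<dots> < \<infinity>"
    using assms by (simp add: BMOA_def bmoa_seminorm_uminus)
  finally show ?thesis by simp
qed

interpretation BMOA: Metric_space BMOA bmoa_dist
proof
  fix f g h
  show "0 \<le> bmoa_dist f g"
    by (simp add: bmoa_dist_def bmoa_norm_def)
  show "bmoa_dist f g = bmoa_dist g f"
    by (simp add: bmoa_dist_def bmoa_norm_def bmoa_seminorm_minus_commute[of f] norm_minus_commute)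
  assume f: "f \<in> BMOA" and g: "g \<in> BMOA"
  show "bmoa_dist f g = 0 \<longleftrightarrow> f = g"
  proof
    define d where "d = (\<lambda>z. f z - g z)"
    assume "bmoa_dist f g = 0"
    then have d0: "d 0 = 0" and "enn2real (bmoa_seminorm d) = 0"
      by (auto simp: bmoa_dist_def bmoa_norm_def d_def add_nonneg_eq_0_iff)
    then have "bmoa_seminorm d = 0"
      using bmoa_seminorm_diff_finite[OF f g] by (auto simp: d_def enn2real_eq_0_iff)
    moreover have "H2_norm (\<lambda>z. d (\<sigma> 0 z) - d 0) \<le> bmoa_seminorm d"
      unfolding bmoa_seminorm_def by (intro SUP_upper) simp
    ultimately have 0: "H2_norm (\<lambda>z. d (\<sigma> 0 z) - d 0) = 0"
      by simp
    have "d holomorphic_on \<bbbD>"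
      using f g by (auto simp: d_def BMOA_def intro!: holomorphic_intros)
    then have c: "continuous_on \<bbbD> (\<lambda>z. d (\<sigma> 0 z) - d 0)"
      by (intro continuous_on_disc_aut_diff) auto
    have "f z = g z" if "z \<in> \<bbbD>" for z
      using H2_norm_eq_0D[OF c 0, of "- z"] that d0 by (simp add: disc_aut_def d_def)
    then show "f = g"
      using f g by (intro extensionalityI[of _ \<bbbD>]) (auto simp: BMOA_def)
  qed (simp add: bmoa_dist_def bmoa_norm_def bmoa_seminorm_def H2_norm_def H2_mean_def)
  assume h: "h \<in> BMOA"
  have "bmoa_seminorm (\<lambda>z. f z - h z) = bmoa_seminorm (\<lambda>z. (f z - g z) + (g z - h z))"
    by simp
  also have "\<dots> \<le> bmoa_seminorm (\<lambda>z. f z - g z) + bmoa_seminorm (\<lambda>z. g z - h z)"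
    using f g h by (intro bmoa_seminorm_triangle holomorphic_intros) (auto simp: BMOA_def)
  finally have "enn2real (bmoa_seminorm (\<lambda>z. f z - h z))
    \<le> enn2real (bmoa_seminorm (\<lambda>z. f z - g z) + bmoa_seminorm (\<lambda>z. g z - h z))"
    using bmoa_seminorm_diff_finite[OF f g] bmoa_seminorm_diff_finite[OF g h]
    by (intro enn2real_mono) auto
  also have "\<dots> = enn2real (bmoa_seminorm (\<lambda>z. f z - g z)) + enn2real (bmoa_seminorm (\<lambda>z. g z - h z))"
    using bmoa_seminorm_diff_finite[OF f g] bmoa_seminorm_diff_finite[OF g h]
    by (intro enn2real_plus) auto
  finally show "bmoa_dist f h \<le> bmoa_dist f g + bmoa_dist g h"
    using norm_triangle_ineq[of "f 0 - g 0" "g 0 - h 0"]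
    by (simp add: bmoa_dist_def bmoa_norm_def)
qed

text \<open>
  Compactness of a linear operator: it maps \<open>BMOA\<close> into itself, and the image of the closed unit
  ball is relatively compact.  The first clause is needed because \<open>closure_of\<close> silently discards
  points outside the space.
\<close>

definition compact_on_BMOA :: "((complex \<Rightarrow> complex) \<Rightarrow> complex \<Rightarrow> complex) \<Rightarrow> bool"
  where "compact_on_BMOA T \<longleftrightarrow>
    T ` BMOA \<subseteq> BMOA \<and>
    compactin BMOA.mtopology (BMOA.mtopology closure_of (T ` {f \<in> BMOA. bmoa_norm f \<le> 1}))"

end

theory Submission
  imports Defs
begin

text \<open>
  Write \<open>\<bar>f\<bar>\<^sub>*\<close> for the seminorm of \<open>BMOA\<close> and \<open>\<parallel>f\<parallel>\<close> for the norm of \<open>H\<^sup>2\<close>.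

  Necessity is a normal families argument (\<open>bmoa_seminorm_vanishes_if_compact\<close>): the automorphisms
  \<open>\<sigma> a\<close> form a bounded subset of \<open>BMOA\<close> and become constant on compact sets as \<open>\<bar>a\<bar> \<rightarrow> 1\<close>, so a compact
  operator sends them to functions whose seminorm tends to \<open>0\<close>.

  For sufficiency, Montel's theorem reduces the claim to a bounded sequence of functions \<open>g\<close> that tends to
  \<open>0\<close> locally uniformly, for which \<open>\<bar>g \<circ> \<phi>\<bar>\<^sub>* \<rightarrow> 0\<close> is to be shown.  The quantity to control is
  \<open>\<parallel>g \<circ> \<phi> \<circ> \<sigma> b - g (\<phi> b)\<parallel>\<close>, uniformly in \<open>b\<close>, and both cases rest on one principle
  (\<open>H2_norm_le_by_stopping\<close>).  The least harmonic majorant of \<open>\<bar>f\<bar>\<^sup>2\<close> has the value \<open>\<parallel>f \<circ> \<sigma> z\<parallel>\<^sup>2\<close> at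
  \<open>z\<close>, so by the maximum principle it can be estimated on a region \<open>\<bar>\<tau>\<bar> \<le> \<rho>\<close> from the values of \<open>\<bar>f\<bar>\<close> in that
  region and the norms \<open>\<parallel>f \<circ> \<sigma> z\<parallel>\<close> on its boundary \<open>\<bar>\<tau>\<bar> = \<rho>\<close>.

  If \<open>\<phi> b\<close> is close to the unit circle, the principle is used with \<open>\<tau> = \<sigma> (\<phi> b) \<circ> \<phi> \<circ> \<sigma> b\<close> and
  \<open>\<rho> = 1 / 2\<close>.  It gives the bound \<open>5 \<bar>g\<bar>\<^sub>* \<parallel>\<tau>\<parallel>\<close> (\<open>H2_norm_compose_le_disc_aut\<close>), and by subordination
  \<open>\<parallel>\<tau>\<parallel> \<le> \<bar>\<sigma> (\<phi> b) \<circ> \<phi>\<bar>\<^sub>*\<close> is small by hypothesis.  If \<open>\<bar>\<phi> b\<bar> < R\<close> for a fixed \<open>R\<close> near \<open>1\<close>, it is used with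
  \<open>\<tau> = \<phi> \<circ> \<sigma> b\<close> and \<open>\<rho> = R\<close>: there \<open>g\<close> is small where \<open>\<bar>\<tau>\<bar> \<le> R\<close>, and on the boundary \<open>\<bar>\<tau>\<bar> = R\<close> the first
  case applies.  The result of both cases is \<open>bmoa_seminorm_compose_small\<close>.
\<close>

section \<open>Means over circles\<close>

definition circle_mean :: "(complex \<Rightarrow> real) \<Rightarrow> real \<Rightarrow> real"
  where "circle_mean u r = integral {0..2 * pi} (\<lambda>t. u (complex_of_real r * cis t)) / (2 * pi)"

lemma H2_mean_eq: "H2_mean f r = sqrt (circle_mean (\<lambda>z. (cmod (f z))\<^sup>2) r)"
  by (simp add: H2_mean_def circle_mean_def)

lemma circle_mean_mono:
  assumes "continuous_on \<bbbD> u" "continuous_on \<bbbD> v" "r \<in> {0..<1}"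
    and "\<And>z. cmod z = r \<Longrightarrow> u z \<le> v z"
  shows "circle_mean u r \<le> circle_mean v r"
  unfolding circle_mean_def
proof (intro divide_right_mono integral_le integrable_continuous_real)
  show "continuous_on {0..2 * pi} (\<lambda>t. u (complex_of_real r * cis t))"
    "continuous_on {0..2 * pi} (\<lambda>t. v (complex_of_real r * cis t))"
    using assms(3) by (auto intro!: continuous_intros continuous_on_compose2[OF assms(1)]
        continuous_on_compose2[OF assms(2)] simp: norm_mult)
qed (use assms(3,4) in \<open>auto simp: norm_mult\<close>)

lemma circle_mean_add_const:
  assumes "continuous_on \<bbbD> u" "r \<in> {0..<1}"
  shows "circle_mean (\<lambda>z. u z + c) r = circle_mean u r + c"
proof -
  have "continuous_on {0..2 * pi} (\<lambda>t. u (complex_of_real r * cis t))"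
    using assms(2) by (auto intro!: continuous_intros continuous_on_compose2[OF assms(1)]
        simp: norm_mult)
  then have "integral {0..2 * pi} (\<lambda>t. u (complex_of_real r * cis t) + c)
      = integral {0..2 * pi} (\<lambda>t. u (complex_of_real r * cis t)) + integral {0..2 * pi} (\<lambda>t. c)"
    by (intro integral_add integrable_continuous_real) auto
  then show ?thesis
    by (simp add: circle_mean_def add_divide_distrib)
qed

lemma Cauchy_formula_circle:
  fixes f :: "complex \<Rightarrow> complex"
  assumes f: "f holomorphic_on \<bbbD>" and r: "r < 1" and z: "cmod z < r"
  shows "((\<lambda>t. f (complex_of_real r * cis t) * (r * cis t / (r * cis t - z)))
    has_integral 2 * pi * f z) {0..2 * pi}"
proof -
  have "((\<lambda>u. f u / (u - z)) has_contour_integral (2 * of_real pi * \<i> * f z)) (circlepath 0 r)"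
    using f r z by (intro Cauchy_integral_circlepath_simple)
      (auto elim!: holomorphic_on_subset)
  then have "((\<lambda>t. f (0 + r * cis t) / (0 + r * cis t - z) * r * \<i> * cis t)
      has_integral 2 * of_real pi * \<i> * f z) {0..2 * pi}"
    unfolding circlepath_def by (subst (asm) has_contour_integral_part_circlepath_iff) auto
  from has_integral_mult_right[OF this, of "- \<i>"] show ?thesis
    by (simp add: field_simps)
qed

lemma circle_mean_Re_holomorphic:
  fixes H :: "complex \<Rightarrow> complex"
  assumes "H holomorphic_on \<bbbD>" "r \<in> {0..<1}"
  shows "circle_mean (\<lambda>z. Re (H z)) r = Re (H 0)"
proof (cases "r = 0")
  case True
  then show ?thesis by (simp add: circle_mean_def)
next
  case False
  with assms(2) have "((\<lambda>t. H (complex_of_real r * cis t) * (r * cis t / (r * cis t - 0)))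
    has_integral 2 * pi * H 0) {0..2 * pi}"
    by (intro Cauchy_formula_circle assms) auto
  then have "((\<lambda>t. H (complex_of_real r * cis t)) has_integral 2 * pi * H 0) {0..2 * pi}"
    using False by simp
  then have "((\<lambda>t. Re (H (complex_of_real r * cis t))) has_integral 2 * pi * Re (H 0)) {0..2 * pi}"
    by (auto dest: has_integral_Re)
  then show ?thesis
    by (simp add: circle_mean_def integral_unique)
qed

text \<open>
  Cauchy's formula is applied to \<open>f\<^sup>2\<close> rather than \<open>f\<close>, so that the quadratic mean appears at once when
  the kernel is bounded by \<open>r / (r - \<bar>z\<bar>)\<close>.
\<close>

lemma norm_le_H2_mean:
  assumes f: "f holomorphic_on \<bbbD>" and r: "r \<in> {0..<1}" and z: "cmod z < r"
  shows "(cmod (f z))\<^sup>2 * (r - cmod z) \<le> r * (H2_mean f r)\<^sup>2"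
proof -
  define I where "I = integral {0..2 * pi} (\<lambda>t. (cmod (f (complex_of_real r * cis t)))\<^sup>2)"
  have i: "((\<lambda>t. (f (complex_of_real r * cis t))\<^sup>2 * (r * cis t / (r * cis t - z)))
    has_integral 2 * pi * (f z)\<^sup>2) {0..2 * pi}"
    using r z by (intro Cauchy_formula_circle[where f = "\<lambda>z. (f z)\<^sup>2"] holomorphic_intros f) auto
  have c: "continuous_on {0..2 * pi} (\<lambda>t. (cmod (f (complex_of_real r * cis t)))\<^sup>2)"
    by (intro continuous_intros continuous_on_circle holomorphic_on_imp_continuous_on f r)
  then have j: "((\<lambda>t. (cmod (f (complex_of_real r * cis t)))\<^sup>2 * (r / (r - cmod z)))
      has_integral I * (r / (r - cmod z))) {0..2 * pi}"
    unfolding I_def by (intro has_integral_mult_left integrable_integral integrable_continuous_real)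
  have "cmod (2 * pi * (f z)\<^sup>2) \<le> integral {0..2 * pi}
      (\<lambda>t. (cmod (f (complex_of_real r * cis t)))\<^sup>2 * (r / (r - cmod z)))"
    unfolding integral_unique[OF i, symmetric]
  proof (rule integral_norm_bound_integral)
    fix t :: real
    have "r - cmod z \<le> cmod (r * cis t - z)"
      using norm_triangle_ineq2[of "r * cis t" z] r by (simp add: norm_mult)
    then have "r / cmod (r * cis t - z) \<le> r / (r - cmod z)"
      using r z by (intro divide_left_mono) (auto intro!: mult_pos_pos)
    then show "cmod ((f (complex_of_real r * cis t))\<^sup>2 * (r * cis t / (r * cis t - z)))
        \<le> (cmod (f (complex_of_real r * cis t)))\<^sup>2 * (r / (r - cmod z))"
      using r by (auto simp: norm_mult norm_divide norm_power simp del: times_divide_eq_right intro!: mult_left_mono)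
  qed (use i j in \<open>auto simp: has_integral_integrable_integral\<close>)
  also have "\<dots> = I * (r / (r - cmod z))"
    using j by (rule integral_unique)
  finally have "cmod (2 * pi * (f z)\<^sup>2) \<le> I * (r / (r - cmod z))" .
  then have "2 * pi * (cmod (f z))\<^sup>2 \<le> I * r / (r - cmod z)"
    by (simp add: norm_mult norm_power)
  then have "2 * pi * ((cmod (f z))\<^sup>2 * (r - cmod z)) \<le> I * r"
    using z by (simp add: pos_le_divide_eq mult.assoc)
  also have "I = 2 * pi * (H2_mean f r)\<^sup>2"
    using H2_mean_nonneg[of f r] by (simp add: H2_mean_def I_def)
  finally show ?thesis
    by (simp add: mult.assoc mult.commute)
qed

section \<open>Approximate harmonic majorants\<close>

lemma cmod_add_power2: "(cmod (c + u))\<^sup>2 = (cmod c)\<^sup>2 + 2 * Re (cnj c * u) + (cmod u)\<^sup>2"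
  by (simp only: cmod_power2) (simp add: power2_eq_square algebra_simps)

text \<open>
  The real part of \<open>q\<close> is the harmonic function on the disc of radius \<open>s\<close> with boundary values
  \<open>\<bar>p\<bar>\<^sup>2\<close>.  For polynomials it can be written down by recursion on the coefficients, which replaces the
  Poisson integral: if \<open>p = c + z p\<^sub>1\<close> and \<open>q\<^sub>1\<close> serves \<open>p\<^sub>1\<close>, expand
  \<open>\<bar>p\<bar>\<^sup>2 = \<bar>c\<bar>\<^sup>2 + 2 Re (cnj c z p\<^sub>1) + \<bar>z\<bar>\<^sup>2 \<bar>p\<^sub>1\<bar>\<^sup>2\<close>.  The first two terms are harmonic, and in the last one
  \<open>\<bar>z\<bar>\<^sup>2\<close> may be replaced by \<open>s\<^sup>2\<close>, with equality on the circle.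
\<close>

lemma poly_harmonic_majorant:
  fixes p :: "complex poly"
  shows "\<exists>q. (\<forall>z. cmod z \<le> s \<longrightarrow> (cmod (poly p z))\<^sup>2 \<le> Re (poly q z)) \<and>
    (\<forall>z. cmod z = s \<longrightarrow> Re (poly q z) = (cmod (poly p z))\<^sup>2)"
proof (induction p)
  case 0
  then show ?case by (intro exI[of _ 0]) simp
next
  case (pCons c p)
  then obtain q where q: "\<And>z. cmod z \<le> s \<Longrightarrow> (cmod (poly p z))\<^sup>2 \<le> Re (poly q z)"
    "\<And>z. cmod z = s \<Longrightarrow> Re (poly q z) = (cmod (poly p z))\<^sup>2"
    by blast
  define q' where "q' = [:of_real ((cmod c)\<^sup>2):] + smult (2 * cnj c) (pCons 0 p) + smult (of_real (s\<^sup>2)) q"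
  have q': "Re (poly q' z) = (cmod c)\<^sup>2 + 2 * Re (cnj c * (z * poly p z)) + s\<^sup>2 * Re (poly q z)" for z
    by (simp add: q'_def algebra_simps flip: of_real_power)
  have p: "(cmod (poly (pCons c p) z))\<^sup>2
      = (cmod c)\<^sup>2 + 2 * Re (cnj c * (z * poly p z)) + (cmod z)\<^sup>2 * (cmod (poly p z))\<^sup>2" for z
    by (simp only: poly_pCons cmod_add_power2 norm_mult power_mult_distrib)
  have le: "(cmod z)\<^sup>2 * (cmod (poly p z))\<^sup>2 \<le> s\<^sup>2 * Re (poly q z)" if "cmod z \<le> s" for z
    using that q(1)[OF that] by (intro mult_mono power_mono) auto
  have "(cmod (poly (pCons c p) z))\<^sup>2 \<le> Re (poly q' z)" if "cmod z \<le> s" for z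
    unfolding p q' using le[OF that] by linarith
  moreover have "Re (poly q' z) = (cmod (poly (pCons c p) z))\<^sup>2" if "cmod z = s" for z
    unfolding p q' by (simp add: q(2)[OF that] that)
  ultimately show ?case by blast
qed

text \<open>
  Taylor sums converge uniformly on smaller discs.
\<close>

lemma holomorphic_poly_approx:
  assumes f: "f holomorphic_on \<bbbD>" and s: "0 \<le> s" "s < 1" and e: "e > 0"
  shows "\<exists>p. \<forall>z\<in>cball 0 s. cmod (f z - poly p z) < e"
proof -
  define a where "a = (\<lambda>n. (deriv ^^ n) f 0 / fact n)"
  have sums: "(\<lambda>n. a n * z ^ n) sums f z" if "cmod z < 1" for z
    using holomorphic_power_series[OF f, of z] that by (simp add: a_def)
  define x where "x = (s + 1) / 2"
  have x: "s < x" "x < 1" using s by (auto simp: x_def)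
  have "summable (\<lambda>n. a n * complex_of_real x ^ n)"
    using sums[of "of_real x"] x s by (auto simp: sums_iff)
  from conv_radius_geI[OF this] have "ereal x \<le> conv_radius a"
    using x s by simp
  then have "ereal s < conv_radius a"
    using x by (metis ereal_less_eq(3) less_ereal.simps(1) order_less_le_trans)
  from powser_uniform_limit[OF this, of 0]
  have "uniform_limit (cball 0 s) (\<lambda>n z. \<Sum>i<n. a i * z ^ i) f sequentially"
  proof (rule uniform_limit_cong'[THEN iffD1, rotated -1])
    show "(\<Sum>n. a n * (z - 0) ^ n) = f z" if "z \<in> cball 0 s" for z
      using sums[of z] that s by (auto simp: sums_iff)
  qed auto
  then have "\<forall>\<^sub>F n in sequentially. \<forall>z\<in>cball 0 s. dist (\<Sum>i<n. a i * z ^ i) (f z) < e"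
    using e by (auto simp: uniform_limit_iff)
  then obtain n where n: "\<forall>z\<in>cball 0 s. dist (\<Sum>i<n. a i * z ^ i) (f z) < e"
    by (auto simp: eventually_sequentially)
  show ?thesis
    using n by (intro exI[of _ "\<Sum>i<n. monom (a i) i"])
      (auto simp: poly_sum poly_monom dist_norm norm_minus_commute)
qed

text \<open>
  The form in which harmonic majorants are used: \<open>Re H\<close> dominates \<open>\<bar>f\<bar>\<^sup>2\<close> inside and agrees with it on the
  circle, up to an error that is sent to \<open>0\<close> in every application.  With this tolerance \<open>H\<close> can be taken
  entire, so that the maximum principle never meets a question of boundary regularity.
\<close>

lemma approx_harmonic_majorant:
  assumes f: "f holomorphic_on \<bbbD>" and s: "0 \<le> s" "s < 1" and e: "e > 0"
  obtains H where "H holomorphic_on UNIV"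
    "\<And>z. cmod z \<le> s \<Longrightarrow> (cmod (f z))\<^sup>2 \<le> Re (H z) + e"
    "\<And>z. cmod z = s \<Longrightarrow> Re (H z) \<le> (cmod (f z))\<^sup>2 + e"
proof -
  have "continuous_on (cball 0 s) f"
    using s by (intro holomorphic_on_imp_continuous_on holomorphic_on_subset[OF f]) auto
  then have "bounded (f ` cball 0 s)"
    by (intro compact_imp_bounded compact_continuous_image) auto
  then obtain B where "B > 0" and B0: "\<forall>x\<in>f ` cball 0 s. cmod x \<le> B"
    unfolding bounded_pos by blast
  have B: "cmod (f z) \<le> B" if "cmod z \<le> s" for z
    using B0 that by simp
  \<comment> \<open>chosen so that \<open>\<bar>f - p\<bar> < d\<close> forces \<open>\<bar>\<bar>f\<bar>\<^sup>2 - \<bar>p\<bar>\<^sup>2\<bar> \<le> d (2 B + d) \<le> e\<close>\<close>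
  define d where "d = min 1 (e / (2 * B + 1))"
  have d: "d > 0" "d \<le> 1"
    using e \<open>B > 0\<close> by (auto simp: d_def)
  have "d \<le> e / (2 * B + 1)"
    by (simp add: d_def)
  then have de: "d * (2 * B + 1) \<le> e"
    using \<open>B > 0\<close> by (simp add: pos_le_divide_eq)
  obtain p where "\<forall>z\<in>cball 0 s. cmod (f z - poly p z) < d"
    using holomorphic_poly_approx[OF f s d(1)] by blast
  then have p: "cmod (f z - poly p z) < d" if "cmod z \<le> s" for z
    using that by simp
  have fp: "\<bar>(cmod (f z))\<^sup>2 - (cmod (poly p z))\<^sup>2\<bar> \<le> e" if z: "cmod z \<le> s" for z
  proof -
    have 1: "\<bar>cmod (f z) - cmod (poly p z)\<bar> \<le> d"
      using p[OF z] norm_triangle_ineq3[of "f z" "poly p z"] by linarith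
    have "\<bar>(cmod (f z))\<^sup>2 - (cmod (poly p z))\<^sup>2\<bar>
        = \<bar>cmod (f z) - cmod (poly p z)\<bar> * (cmod (f z) + cmod (poly p z))"
      by (simp add: power2_eq_square square_diff_square_factored abs_mult)
    also have "\<dots> \<le> d * (2 * B + 1)"
      using 1 d B[OF z] by (intro mult_mono) auto
    finally show ?thesis using de by linarith
  qed
  obtain q where q: "\<And>z. cmod z \<le> s \<Longrightarrow> (cmod (poly p z))\<^sup>2 \<le> Re (poly q z)"
    "\<And>z. cmod z = s \<Longrightarrow> Re (poly q z) = (cmod (poly p z))\<^sup>2"
    using poly_harmonic_majorant[of s p] by blast
  show ?thesis
  proof (rule that[of "poly q"])
    show "poly q holomorphic_on UNIV"
      by (intro holomorphic_intros)
    show "(cmod (f z))\<^sup>2 \<le> Re (poly q z) + e" if "cmod z \<le> s" for z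
      using fp[OF that] q(1)[OF that] by linarith
    show "Re (poly q z) \<le> (cmod (f z))\<^sup>2 + e" if "cmod z = s" for z
      using fp[of z] q(2)[OF that] that by simp
  qed
qed

section \<open>The Hardy norm and subordination\<close>

lemma H2_norm_leI:
  assumes "\<And>r. r \<in> {0..<1} \<Longrightarrow> H2_mean f r \<le> M"
  shows "H2_norm f \<le> ennreal M"
  unfolding H2_norm_def using assms by (intro SUP_least ennreal_leI)

lemma H2_mean_leD:
  assumes "H2_norm f \<le> ennreal M" "M \<ge> 0" "r \<in> {0..<1}"
  shows "H2_mean f r \<le> M"
proof -
  have "ennreal (H2_mean f r) \<le> H2_norm f"
    unfolding H2_norm_def by (intro SUP_upper assms(3))
  also have "\<dots> \<le> ennreal M" by fact
  finally show ?thesis using assms(2) by simp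
qed

lemma H2_norm_mono:
  assumes "\<And>r. r \<in> {0..<1} \<Longrightarrow> H2_mean f r \<le> H2_mean g r"
  shows "H2_norm f \<le> H2_norm g"
  unfolding H2_norm_def by (intro SUP_mono) (use assms in \<open>blast intro: ennreal_leI\<close>)

lemma H2_norm_cong:
  assumes "\<And>z. z \<in> \<bbbD> \<Longrightarrow> f z = g z"
  shows "H2_norm f = H2_norm g"
proof -
  have "H2_mean f r = H2_mean g r" if "r \<in> {0..<1}" for r
    unfolding H2_mean_def using assms circle_in_disc[OF that] by simp
  then show ?thesis by (simp add: H2_norm_def)
qed

lemma H2_norm_const: "H2_norm (\<lambda>z. c) = ennreal (cmod c)"
proof -
  have "H2_mean (\<lambda>z. c) r = cmod c" for r
    by (simp add: H2_mean_def)
  then show ?thesis by (simp add: H2_norm_def)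
qed

lemma H2_norm_cmult: "H2_norm (\<lambda>z. c * f z) = ennreal (cmod c) * H2_norm f"
proof -
  have "H2_mean (\<lambda>z. c * f z) r = cmod c * H2_mean f r" for r
    by (simp add: H2_mean_def norm_mult power_mult_distrib real_sqrt_mult real_sqrt_divide)
  then show ?thesis
    by (simp add: H2_norm_def ennreal_mult' SUP_mult_left_ennreal)
qed

lemma H2_norm_add_const:
  assumes "continuous_on \<bbbD> f"
  shows "H2_norm (\<lambda>z. f z + c) \<le> H2_norm f + ennreal (cmod c)"
  using H2_norm_triangle[OF assms continuous_on_const[of _ c]] by (simp add: H2_norm_const)

text \<open>
  This is what lets estimates in \<open>H\<^sup>2\<close> control values in the disc; it is the pointwise bound on circles
  in the limit \<open>r \<rightarrow> 1\<close>.
\<close>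

lemma norm_le_H2_norm:
  assumes f: "f holomorphic_on \<bbbD>" and M: "H2_norm f \<le> ennreal M" "M \<ge> 0" and z: "z \<in> \<bbbD>"
  shows "(cmod (f z))\<^sup>2 * (1 - cmod z) \<le> M\<^sup>2"
proof (rule field_le_mult_one_interval)
  fix t :: real
  assume t: "0 < t" "t < 1"
  define r where "r = cmod z + t * (1 - cmod z)"
  have "t * (1 - cmod z) < 1 * (1 - cmod z)"
    using t z by (intro mult_strict_right_mono) auto
  then have "r < 1"
    by (simp add: r_def)
  moreover have "cmod z < r"
    using t z by (simp add: r_def)
  ultimately have r: "r \<in> {0..<1}" "cmod z < r"
    using norm_ge_zero[of z] by (auto simp del: norm_ge_zero)
  have "(cmod (f z))\<^sup>2 * (r - cmod z) \<le> r * (H2_mean f r)\<^sup>2"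
    by (rule norm_le_H2_mean[OF f r])
  also have "\<dots> \<le> 1 * M\<^sup>2"
    using r H2_mean_leD[OF M r(1)] H2_mean_nonneg[of f r] by (intro mult_mono power_mono) auto
  finally show "t * ((cmod (f z))\<^sup>2 * (1 - cmod z)) \<le> M\<^sup>2"
    by (simp add: r_def mult_ac)
qed

text \<open>
  Littlewood's subordination principle.  By the Schwarz lemma \<open>\<omega>\<close> maps the disc of radius \<open>r\<close> into
  itself, so on the circle \<open>\<bar>f \<circ> \<omega>\<bar>\<^sup>2\<close> is dominated by \<open>Re H \<circ> \<omega>\<close>, where \<open>Re H\<close> is the harmonic majorant of
  \<open>\<bar>f\<bar>\<^sup>2\<close>.  The mean of \<open>Re H \<circ> \<omega>\<close> is its value \<open>Re H 0\<close> at the centre, which is also the mean of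
  \<open>\<bar>f\<bar>\<^sup>2\<close>.
\<close>

lemma H2_mean_subordination:
  assumes f: "f holomorphic_on \<bbbD>" and \<omega>: "\<omega> holomorphic_on \<bbbD>" "\<omega> ` \<bbbD> \<subseteq> \<bbbD>" "\<omega> 0 = 0"
    and r: "r \<in> {0..<1}"
  shows "H2_mean (\<lambda>z. f (\<omega> z)) r \<le> H2_mean f r"
proof -
  have Schwarz: "cmod (\<omega> z) \<le> cmod z" if "cmod z < 1" for z
    using \<omega> that by (intro Schwarz_Lemma(1)) (auto simp: image_subset_iff)
  have fw: "(\<lambda>z. f (\<omega> z)) holomorphic_on \<bbbD>"
    using holomorphic_on_compose_gen[OF \<omega>(1) f \<omega>(2)] by (simp add: o_def)
  have "circle_mean (\<lambda>z. (cmod (f (\<omega> z)))\<^sup>2) r \<le> circle_mean (\<lambda>z. (cmod (f z))\<^sup>2) r + e"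
    if e: "e > 0" for e
  proof -
    obtain H where H: "H holomorphic_on UNIV"
      "\<And>z. cmod z \<le> r \<Longrightarrow> (cmod (f z))\<^sup>2 \<le> Re (H z) + e / 2"
      "\<And>z. cmod z = r \<Longrightarrow> Re (H z) \<le> (cmod (f z))\<^sup>2 + e / 2"
      using approx_harmonic_majorant[OF f, of r "e / 2"] r e by auto
    have Hw: "(\<lambda>z. H (\<omega> z)) holomorphic_on \<bbbD>"
      using holomorphic_on_compose_gen[OF \<omega>(1) H(1)] by (simp add: o_def)
    have HD: "H holomorphic_on \<bbbD>"
      using H(1) by (rule holomorphic_on_subset) auto
    note c = continuous_intros holomorphic_on_imp_continuous_on fw f HD Hw
    have "circle_mean (\<lambda>z. (cmod (f (\<omega> z)))\<^sup>2) r \<le> circle_mean (\<lambda>z. Re (H (\<omega> z)) + e / 2) r"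
      using r Schwarz by (intro circle_mean_mono H(2) c) auto
    also have "\<dots> = Re (H (\<omega> 0)) + e / 2"
      using circle_mean_Re_holomorphic[OF Hw r]
      by (subst circle_mean_add_const) (intro c r | simp)+
    also have "\<dots> = circle_mean (\<lambda>z. Re (H z)) r + e / 2"
      using circle_mean_Re_holomorphic[OF HD r] \<omega>(3) by simp
    also have "circle_mean (\<lambda>z. Re (H z)) r \<le> circle_mean (\<lambda>z. (cmod (f z))\<^sup>2 + e / 2) r"
      using r by (intro circle_mean_mono H(3) c) auto
    also have "\<dots> = circle_mean (\<lambda>z. (cmod (f z))\<^sup>2) r + e / 2"
      by (intro circle_mean_add_const c r)
    finally show ?thesis by simp
  qed
  then have "circle_mean (\<lambda>z. (cmod (f (\<omega> z)))\<^sup>2) r \<le> circle_mean (\<lambda>z. (cmod (f z))\<^sup>2) r"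
    by (rule field_le_epsilon)
  then show ?thesis by (simp add: H2_mean_eq)
qed

lemma H2_norm_subordination:
  assumes "f holomorphic_on \<bbbD>" "\<omega> holomorphic_on \<bbbD>" "\<omega> ` \<bbbD> \<subseteq> \<bbbD>" "\<omega> 0 = 0"
  shows "H2_norm (\<lambda>z. f (\<omega> z)) \<le> H2_norm f"
  by (intro H2_norm_mono H2_mean_subordination assms)

lemma disc_aut_involution:
  assumes "a \<in> \<bbbD>" "z \<in> \<bbbD>"
  shows "\<sigma> a (\<sigma> a z) = z"
proof -
  have "\<sigma> a (\<sigma> a z) = Moebius_function 0 (- a) (Moebius_function 0 a z)"
    by (simp add: disc_aut_Moebius Moebius_function_simple divide_simps)
  also have "\<dots> = z"
    using assms by (intro Moebius_function_compose) auto
  finally show ?thesis .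
qed

lemma disc_aut_self [simp]: "\<sigma> a a = 0"
  by (simp add: disc_aut_def)

lemma disc_aut_at_0 [simp]: "\<sigma> a 0 = a"
  by (simp add: disc_aut_def)

lemma holomorphic_on_disc_compose:
  assumes "g holomorphic_on \<bbbD>" "\<theta> holomorphic_on \<bbbD>" "\<theta> ` \<bbbD> \<subseteq> \<bbbD>"
  shows "(\<lambda>z. g (\<theta> z)) holomorphic_on \<bbbD>"
  using holomorphic_on_compose_gen[OF assms(2,1,3)] by (simp add: o_def)

text \<open>
  Every self-map \<open>\<theta>\<close> of the disc factors as \<open>\<sigma> b \<circ> (\<sigma> b \<circ> \<theta>)\<close> with \<open>b = \<theta> 0\<close>, and the second factor fixes
  the origin.  Hence subordination bounds the oscillation of \<open>g \<circ> \<theta>\<close> about its central value by the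
  oscillation at the point \<open>b\<close>: in the definition of the seminorm, arbitrary self-maps may take the place
  of the automorphisms.
\<close>

lemma H2_norm_compose_le_bmoa_seminorm:
  assumes g: "g holomorphic_on \<bbbD>" and \<theta>: "\<theta> holomorphic_on \<bbbD>" "\<theta> ` \<bbbD> \<subseteq> \<bbbD>"
  shows "H2_norm (\<lambda>z. g (\<theta> z) - g (\<theta> 0)) \<le> bmoa_seminorm g"
proof -
  define b where "b = \<theta> 0"
  have b: "b \<in> \<bbbD>" using \<theta>(2) by (auto simp: b_def image_subset_iff)
  define G where "G = (\<lambda>w. g (\<sigma> b w) - g b)"
  have aut: "\<sigma> b holomorphic_on \<bbbD>" "\<sigma> b ` \<bbbD> \<subseteq> \<bbbD>"
    using disc_aut_holomorphic[OF b] disc_aut_in_disc[OF b] by auto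
  have "G holomorphic_on \<bbbD>"
    unfolding G_def by (intro holomorphic_on_diff holomorphic_on_const holomorphic_on_disc_compose[OF g aut])
  then have "H2_norm (\<lambda>z. G (\<sigma> b (\<theta> z))) \<le> H2_norm G"
    using \<theta>(2) aut(2)
    by (intro H2_norm_subordination holomorphic_on_disc_compose[OF aut(1) \<theta>]) (auto simp: b_def)
  also have "H2_norm (\<lambda>z. G (\<sigma> b (\<theta> z))) = H2_norm (\<lambda>z. g (\<theta> z) - g (\<theta> 0))"
    using \<theta>(2) b by (intro H2_norm_cong) (auto simp: G_def disc_aut_involution image_subset_iff simp flip: b_def)
  also have "H2_norm G \<le> bmoa_seminorm g"
    unfolding bmoa_seminorm_def G_def by (intro SUP_upper b)
  finally show ?thesis .
qed

lemma bmoa_seminorm_compose_le: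
  assumes g: "g holomorphic_on \<bbbD>" and \<theta>: "\<theta> holomorphic_on \<bbbD>" "\<theta> ` \<bbbD> \<subseteq> \<bbbD>"
  shows "bmoa_seminorm (\<lambda>z. g (\<theta> z)) \<le> bmoa_seminorm g"
  unfolding bmoa_seminorm_def[of "\<lambda>z. g (\<theta> z)"]
proof (intro SUP_least)
  fix a assume a: "a \<in> \<bbbD>"
  have "(\<lambda>z. \<theta> (\<sigma> a z)) holomorphic_on \<bbbD>"
    using disc_aut_in_disc[OF a]
    by (intro holomorphic_on_disc_compose[OF \<theta>(1) disc_aut_holomorphic[OF a]]) auto
  from H2_norm_compose_le_bmoa_seminorm[OF g this]
  show "H2_norm (\<lambda>z. g (\<theta> (\<sigma> a z)) - g (\<theta> a)) \<le> bmoa_seminorm g"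
    using \<theta>(2) disc_aut_in_disc[OF a] by (auto simp: image_subset_iff)
qed

section \<open>A stopping principle\<close>

text \<open>
  The least harmonic majorant of \<open>\<bar>f\<bar>\<^sup>2\<close> on the whole disc has at \<open>a\<close> the value
  \<open>\<parallel>f \<circ> \<sigma> a\<parallel>\<^sup>2\<close>, so a harmonic function with boundary values \<open>\<bar>f\<bar>\<^sup>2\<close> on a smaller circle lies
  below that number at \<open>a\<close>.  For the proof the majorant \<open>Re K\<close> of \<open>\<bar>f \<circ> \<sigma> a\<bar>\<^sup>2\<close> on a disc large enough
  to contain \<open>\<sigma> a ` cball 0 s\<close> is carried back by \<open>\<sigma> a\<close> and compared with \<open>Re H\<close> by the maximum
  principle.
\<close>

lemma harmonic_le_H2_norm:
  assumes f: "f holomorphic_on \<bbbD>" and H: "H holomorphic_on UNIV" and s: "0 \<le> s" "s < 1" and e: "e > 0"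
    and le: "\<And>z. cmod z = s \<Longrightarrow> Re (H z) \<le> (cmod (f z))\<^sup>2 + e"
    and a: "cmod a \<le> s" and M: "H2_norm (\<lambda>z. f (\<sigma> a z)) \<le> ennreal M" "M \<ge> 0"
  shows "Re (H a) \<le> M\<^sup>2 + 3 * e"
proof -
  have aD: "a \<in> \<bbbD>" using a s by simp
  have aut: "\<sigma> a holomorphic_on \<bbbD>" "\<sigma> a ` \<bbbD> \<subseteq> \<bbbD>"
    using disc_aut_holomorphic[OF aD] disc_aut_in_disc[OF aD] by auto
  have sD: "cball 0 s \<subseteq> \<bbbD>" using s by auto
  have "\<exists>x\<in>cball 0 s. \<forall>y\<in>cball 0 s. cmod (\<sigma> a y) \<le> cmod (\<sigma> a x)"
    using s by (intro continuous_attains_sup continuous_intros holomorphic_on_imp_continuous_on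
        holomorphic_on_subset[OF aut(1) sD]) auto
  then obtain x where x: "x \<in> cball 0 s" "\<And>y. y \<in> cball 0 s \<Longrightarrow> cmod (\<sigma> a y) \<le> cmod (\<sigma> a x)"
    by blast
  define r where "r = cmod (\<sigma> a x)"
  have r: "r \<in> {0..<1}"
    using x(1) sD aut(2) by (force simp: r_def)
  have fa: "(\<lambda>z. f (\<sigma> a z)) holomorphic_on \<bbbD>"
    by (rule holomorphic_on_disc_compose[OF f aut])
  obtain K where K: "K holomorphic_on UNIV"
      "\<And>z. cmod z \<le> r \<Longrightarrow> (cmod (f (\<sigma> a z)))\<^sup>2 \<le> Re (K z) + e"
      "\<And>z. cmod z = r \<Longrightarrow> Re (K z) \<le> (cmod (f (\<sigma> a z)))\<^sup>2 + e"
    using approx_harmonic_majorant[OF fa, of r e] r e by auto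
  have KD: "K holomorphic_on \<bbbD>"
    using K(1) by (rule holomorphic_on_subset) auto
  note c = continuous_intros holomorphic_on_imp_continuous_on fa KD
  have "Re (K 0) = circle_mean (\<lambda>z. Re (K z)) r"
    using circle_mean_Re_holomorphic[OF KD r] by simp
  also have "\<dots> \<le> circle_mean (\<lambda>z. (cmod (f (\<sigma> a z)))\<^sup>2 + e) r"
    using r by (intro circle_mean_mono K(3) c) auto
  also have "\<dots> = circle_mean (\<lambda>z. (cmod (f (\<sigma> a z)))\<^sup>2) r + e"
    by (intro circle_mean_add_const c r)
  also have "circle_mean (\<lambda>z. (cmod (f (\<sigma> a z)))\<^sup>2) r \<le> M\<^sup>2"
    using H2_mean_leD[OF M r] M(2) by (simp add: H2_mean_eq real_sqrt_le_iff' sqrt_le_D)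
  finally have K0: "Re (K 0) \<le> M\<^sup>2 + e" by simp
  define E where "E = (\<lambda>z. H z - K (\<sigma> a z))"
  have Ehol: "E holomorphic_on \<bbbD>"
    unfolding E_def by (intro holomorphic_on_diff holomorphic_on_disc_compose[OF KD aut]
        holomorphic_on_subset[OF H]) auto
  have "Re (E a) \<le> 2 * e"
  proof (rule maximum_real_frontier[of E "cball 0 s"])
    show "E holomorphic_on interior (cball 0 s)"
      using sD by (intro holomorphic_on_subset[OF Ehol]) (auto simp: subset_iff)
    show "continuous_on (closure (cball 0 s)) E"
      using sD by (intro holomorphic_on_imp_continuous_on holomorphic_on_subset[OF Ehol]) auto
    fix z :: complex assume "z \<in> frontier (cball 0 s)"
    then have z: "cmod z = s" by (simp add: frontier_cball)
    then have "(cmod (f (\<sigma> a (\<sigma> a z))))\<^sup>2 \<le> Re (K (\<sigma> a z)) + e"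
      using x(2)[of z] by (intro K(2)) (simp add: r_def)
    with le[OF z] show "Re (E z) \<le> 2 * e"
      using disc_aut_involution[OF aD, of z] z s by (simp add: E_def)
  qed (use a in auto)
  with K0 show ?thesis by (simp add: E_def)
qed

text \<open>
  Think of Brownian motion started at \<open>0\<close> and of \<open>\<parallel>f\<parallel>\<^sup>2\<close> as the expectation of \<open>\<bar>f\<bar>\<^sup>2\<close> on exit from the
  disc.  Stop the motion when \<open>\<bar>\<tau>\<bar>\<close> first reaches \<open>\<rho>\<close>.  Paths that leave the disc before that contribute at
  most \<open>\<bar>h\<bar>\<^sup>2\<close>; for a path stopped at \<open>z\<close> the expected final value is \<open>\<parallel>f \<circ> \<sigma> z\<parallel>\<^sup>2\<close>, which is
  at most \<open>\<bar>h z\<bar>\<^sup>2\<close> and hence, by subharmonicity, at most the expected final value of \<open>\<bar>h\<bar>\<^sup>2\<close>.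

  Analytically this is the maximum principle on \<open>{z. \<bar>z\<bar> \<le> s \<and> \<bar>\<tau> z\<bar> \<le> \<rho>}\<close> for the difference of the harmonic
  majorants of \<open>\<bar>f\<bar>\<^sup>2\<close> and \<open>\<bar>h\<bar>\<^sup>2\<close> on the disc of radius \<open>s\<close>.
\<close>

theorem H2_norm_le_by_stopping:
  assumes f: "f holomorphic_on \<bbbD>" and h: "h holomorphic_on \<bbbD>" and \<tau>: "continuous_on \<bbbD> \<tau>"
    and inside: "\<And>z. z \<in> \<bbbD> \<Longrightarrow> cmod (\<tau> z) \<le> \<rho> \<Longrightarrow> cmod (f z) \<le> cmod (h z)"
    and boundary: "\<And>z. z \<in> \<bbbD> \<Longrightarrow> cmod (\<tau> z) = \<rho> \<Longrightarrow> H2_norm (\<lambda>w. f (\<sigma> z w)) \<le> ennreal (cmod (h z))"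
    and 0: "cmod (\<tau> 0) \<le> \<rho>"
  shows "H2_norm f \<le> H2_norm h"
proof -
  have "H2_mean f s \<le> H2_mean h s" if s: "s \<in> {0..<1}" for s
  proof -
    have "circle_mean (\<lambda>z. (cmod (f z))\<^sup>2) s \<le> circle_mean (\<lambda>z. (cmod (h z))\<^sup>2) s + d"
      if d: "d > 0" for d
    proof -
      \<comment> \<open>The comparison below loses \<open>e\<close> six times: four times at the frontier, once in each mean.\<close>
      define e where "e = d / 6"
      have e: "e > 0" using d by (simp add: e_def)
      obtain F where F: "F holomorphic_on UNIV"
          "\<And>z. cmod z \<le> s \<Longrightarrow> (cmod (f z))\<^sup>2 \<le> Re (F z) + e"
          "\<And>z. cmod z = s \<Longrightarrow> Re (F z) \<le> (cmod (f z))\<^sup>2 + e"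
        using approx_harmonic_majorant[OF f, of s e] s e by auto
      obtain K where K: "K holomorphic_on UNIV"
          "\<And>z. cmod z \<le> s \<Longrightarrow> (cmod (h z))\<^sup>2 \<le> Re (K z) + e"
          "\<And>z. cmod z = s \<Longrightarrow> Re (K z) \<le> (cmod (h z))\<^sup>2 + e"
        using approx_harmonic_majorant[OF h, of s e] s e by auto
      define S where "S = cball 0 s \<inter> \<tau> -` cball 0 \<rho>"
      have sD: "cball 0 s \<subseteq> \<bbbD>" "ball 0 s \<subseteq> \<bbbD>" using s by auto
      have closedS: "closed S"
        unfolding S_def
        by (intro continuous_closed_preimage continuous_on_subset[OF \<tau> sD(1)]) auto
      have "open (ball 0 s \<inter> \<tau> -` ball 0 \<rho>)"
        by (intro continuous_open_preimage continuous_on_subset[OF \<tau> sD(2)]) auto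
      then have interiorS: "ball 0 s \<inter> \<tau> -` ball 0 \<rho> \<subseteq> interior S"
        by (intro interior_maximal) (auto simp: S_def)
      have "Re (F 0 - K 0) \<le> 4 * e"
      proof (rule maximum_real_frontier[of "\<lambda>z. F z - K z" S])
        show "(\<lambda>z. F z - K z) holomorphic_on interior S"
          by (intro holomorphic_intros holomorphic_on_subset[OF F(1)] holomorphic_on_subset[OF K(1)]) auto
        show "continuous_on (closure S) (\<lambda>z. F z - K z)"
          by (intro holomorphic_on_imp_continuous_on holomorphic_intros
              holomorphic_on_subset[OF F(1)] holomorphic_on_subset[OF K(1)]) auto
        show "bounded S"
          unfolding S_def by (rule bounded_subset[OF bounded_cball]) auto
        show "0 \<in> S"
          using 0 s by (simp add: S_def)
        fix z assume "z \<in> frontier S"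
        then have "z \<in> S" "z \<notin> interior S"
          using closedS by (auto simp: frontier_def)
        then have zs: "cmod z \<le> s" and zr: "cmod (\<tau> z) \<le> \<rho>"
          and "z \<notin> ball 0 s \<inter> \<tau> -` ball 0 \<rho>"
          using interiorS by (auto simp: S_def)
        then have "cmod z = s \<or> cmod (\<tau> z) = \<rho>" by auto
        have zD: "z \<in> \<bbbD>" using zs s by simp
        have sq: "(cmod (f z))\<^sup>2 \<le> (cmod (h z))\<^sup>2"
          using inside[OF zD zr] by (intro power_mono) auto
        have "Re (F z) \<le> (cmod (h z))\<^sup>2 + 3 * e"
          using \<open>cmod z = s \<or> cmod (\<tau> z) = \<rho>\<close>
        proof
          assume "cmod z = s"
          from F(3)[OF this] sq e show ?thesis by linarith
        next
          assume "cmod (\<tau> z) = \<rho>"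
          from boundary[OF zD this] show ?thesis
            using s by (intro harmonic_le_H2_norm[OF f F(1) _ _ e F(3) zs]) auto
        qed
        with K(2)[OF zs] show "Re (F z - K z) \<le> 4 * e" by simp
      qed
      have FD: "F holomorphic_on \<bbbD>" and KD: "K holomorphic_on \<bbbD>"
        using F(1) K(1) by (auto intro: holomorphic_on_subset)
      note c = continuous_intros holomorphic_on_imp_continuous_on f h FD KD
      have "circle_mean (\<lambda>z. (cmod (f z))\<^sup>2) s \<le> circle_mean (\<lambda>z. Re (F z) + e) s"
        using s by (intro circle_mean_mono F(2) c) auto
      also have "\<dots> = Re (F 0) + e"
        using circle_mean_Re_holomorphic[OF FD s] by (subst circle_mean_add_const) (intro c s | simp)+
      also have "\<dots> \<le> Re (K 0) + 5 * e"
        using \<open>Re (F 0 - K 0) \<le> 4 * e\<close> by simp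
      also have "Re (K 0) = circle_mean (\<lambda>z. Re (K z)) s"
        using circle_mean_Re_holomorphic[OF KD s] by simp
      also have "\<dots> \<le> circle_mean (\<lambda>z. (cmod (h z))\<^sup>2 + e) s"
        using s by (intro circle_mean_mono K(3) c) auto
      also have "\<dots> = circle_mean (\<lambda>z. (cmod (h z))\<^sup>2) s + e"
        by (intro circle_mean_add_const c s)
      finally show ?thesis by (simp add: e_def)
    qed
    then have "circle_mean (\<lambda>z. (cmod (f z))\<^sup>2) s \<le> circle_mean (\<lambda>z. (cmod (h z))\<^sup>2) s"
      by (rule field_le_epsilon)
    then show ?thesis by (simp add: H2_mean_eq)
  qed
  then show ?thesis by (rule H2_norm_mono)
qed

section \<open>Oscillation of a composition\<close>

text \<open>
  The pointwise bound in \<open>H\<^sup>2\<close> gives \<open>\<bar>G\<bar> < 2 M\<close> on the disc of radius \<open>3 / 4\<close>; the Schwarz lemma on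
  that disc turns it into a linear bound.
\<close>

lemma norm_le_linear_near_0:
  assumes G: "G holomorphic_on \<bbbD>" "G 0 = 0" and M: "H2_norm G \<le> ennreal M" "M > 0"
    and w: "cmod w \<le> 1 / 2"
  shows "cmod (G w) \<le> 3 * M * cmod w"
proof -
  have bound: "cmod (G u) < 2 * M" if u: "cmod u < 3 / 4" for u
  proof (rule ccontr)
    assume "\<not> ?thesis"
    then have "(2 * M)\<^sup>2 \<le> (cmod (G u))\<^sup>2"
      using M(2) by (intro power_mono) auto
    then have "(2 * M)\<^sup>2 * (1 - cmod u) \<le> (cmod (G u))\<^sup>2 * (1 - cmod u)"
      using u by (intro mult_right_mono) auto
    also have "\<dots> \<le> M\<^sup>2"
      using u M by (intro norm_le_H2_norm[OF G(1)]) auto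
    finally have "M\<^sup>2 * (4 * (1 - cmod u)) \<le> M\<^sup>2 * 1"
      by (simp add: power_mult_distrib algebra_simps)
    then have "4 * (1 - cmod u) \<le> 1"
      using M(2) by (subst (asm) mult_le_cancel_left_pos) auto
    with u show False by simp
  qed
  define S where "S = (\<lambda>u. G (3 / 4 * u) / (2 * M))"
  have "S holomorphic_on \<bbbD>"
    unfolding S_def using M(2)
    by (intro holomorphic_on_divide holomorphic_on_const holomorphic_on_disc_compose[OF G(1)]
        holomorphic_on_mult holomorphic_on_ident) (auto simp: norm_mult)
  moreover have "cmod (S u) < 1" if "cmod u < 1" for u
    using bound[of "3 / 4 * u"] that M(2) by (simp add: S_def norm_mult norm_divide)
  ultimately have "cmod (S (4 / 3 * w)) \<le> cmod (4 / 3 * w)"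
    using w G(2) by (intro Schwarz_Lemma(1)) (auto simp: S_def norm_mult)
  then have "cmod (G w) \<le> 8 / 3 * (M * cmod w)"
    using M(2) by (simp add: S_def norm_mult norm_divide field_simps)
  also have "\<dots> \<le> 3 * (M * cmod w)"
    using M(2) by (intro mult_right_mono) auto
  finally show ?thesis by (simp add: mult.assoc)
qed

text \<open>
  With \<open>b = \<theta> 0\<close> and \<open>\<psi> = \<sigma> b \<circ> \<theta>\<close>, the function on the left is \<open>G \<circ> \<psi>\<close> with \<open>G = g \<circ> \<sigma> b - g b\<close>
  and \<open>G 0 = 0\<close>.  While \<open>\<bar>\<psi>\<bar> \<le> 1 / 2\<close> it is bounded by a multiple of \<open>\<bar>\<psi>\<bar>\<close>.  Beyond that it may be
  unbounded, but from a point where \<open>\<bar>\<psi>\<bar> = 1 / 2\<close> its oscillation is at most \<open>M\<close>, since \<open>g\<close> is in \<open>BMOA\<close>;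
  and \<open>M\<close> is a multiple of \<open>\<bar>\<psi>\<bar>\<close> there.  The stopping principle combines the two regimes.
\<close>

theorem H2_norm_compose_le_disc_aut:
  assumes g: "g holomorphic_on \<bbbD>" and M: "bmoa_seminorm g \<le> ennreal M" "M > 0"
    and \<theta>: "\<theta> holomorphic_on \<bbbD>" "\<theta> ` \<bbbD> \<subseteq> \<bbbD>"
  shows "H2_norm (\<lambda>z. g (\<theta> z) - g (\<theta> 0)) \<le> ennreal (5 * M) * H2_norm (\<lambda>z. \<sigma> (\<theta> 0) (\<theta> z))"
proof -
  define b where "b = \<theta> 0"
  have b: "b \<in> \<bbbD>" using \<theta>(2) by (auto simp: b_def image_subset_iff)
  have aut: "\<sigma> b holomorphic_on \<bbbD>" "\<sigma> b ` \<bbbD> \<subseteq> \<bbbD>"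
    using disc_aut_holomorphic[OF b] disc_aut_in_disc[OF b] by auto
  define f where "f = (\<lambda>z. g (\<theta> z) - g b)"
  define \<psi> where "\<psi> = (\<lambda>z. \<sigma> b (\<theta> z))"
  define G where "G = (\<lambda>w. g (\<sigma> b w) - g b)"
  have f: "f holomorphic_on \<bbbD>"
    unfolding f_def by (intro holomorphic_on_diff holomorphic_on_const holomorphic_on_disc_compose[OF g \<theta>])
  have \<psi>: "\<psi> holomorphic_on \<bbbD>" "\<psi> 0 = 0"
    using holomorphic_on_disc_compose[OF aut(1) \<theta>] by (auto simp: \<psi>_def b_def)
  have G: "G holomorphic_on \<bbbD>" "G 0 = 0"
    unfolding G_def
    by (intro holomorphic_on_diff holomorphic_on_const holomorphic_on_disc_compose[OF g aut]) simp
  have "H2_norm G \<le> bmoa_seminorm g"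
    unfolding bmoa_seminorm_def G_def by (intro SUP_upper b)
  then have GM: "H2_norm G \<le> ennreal M" using M(1) by simp
  have fG: "f z = G (\<psi> z)" if "z \<in> \<bbbD>" for z
    using that \<theta>(2) b by (simp add: f_def G_def \<psi>_def disc_aut_involution image_subset_iff)
  have f_le: "cmod (f z) \<le> 3 * M * cmod (\<psi> z)" if "z \<in> \<bbbD>" "cmod (\<psi> z) \<le> 1 / 2" for z
    using norm_le_linear_near_0[OF G GM M(2) that(2)] fG[OF that(1)] by simp
  have "H2_norm f \<le> H2_norm (\<lambda>z. of_real (5 * M) * \<psi> z)"
  proof (rule H2_norm_le_by_stopping[where \<tau> = \<psi> and \<rho> = "1 / 2"])
    show "(\<lambda>z. complex_of_real (5 * M) * \<psi> z) holomorphic_on \<bbbD>"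
      by (intro holomorphic_intros \<psi>)
    show "continuous_on \<bbbD> \<psi>"
      by (intro holomorphic_on_imp_continuous_on \<psi>)
    fix z assume z: "z \<in> \<bbbD>"
    show "cmod (f z) \<le> cmod (complex_of_real (5 * M) * \<psi> z)" if "cmod (\<psi> z) \<le> 1 / 2"
    proof -
      have "3 * M * cmod (\<psi> z) \<le> 5 * M * cmod (\<psi> z)"
        using M(2) by (intro mult_right_mono) auto
      moreover have "cmod (complex_of_real (5 * M) * \<psi> z) = 5 * M * cmod (\<psi> z)"
        using M(2) by (simp add: norm_mult)
      ultimately show ?thesis using f_le[OF z that] by linarith
    qed
    assume half: "cmod (\<psi> z) = 1 / 2"
    have autz: "\<sigma> z holomorphic_on \<bbbD>" "\<sigma> z ` \<bbbD> \<subseteq> \<bbbD>"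
      using disc_aut_holomorphic[OF z] disc_aut_in_disc[OF z] by auto
    have \<theta>z: "(\<lambda>w. \<theta> (\<sigma> z w)) holomorphic_on \<bbbD>" "(\<lambda>w. \<theta> (\<sigma> z w)) ` \<bbbD> \<subseteq> \<bbbD>"
      using holomorphic_on_disc_compose[OF \<theta>(1) autz] \<theta>(2) autz(2) by (auto simp: image_subset_iff)
    have c: "continuous_on \<bbbD> (\<lambda>w. g (\<theta> (\<sigma> z w)) - g (\<theta> z))"
      by (intro continuous_intros holomorphic_on_imp_continuous_on holomorphic_on_disc_compose[OF g \<theta>z])
    have "H2_norm (\<lambda>w. f (\<sigma> z w)) = H2_norm (\<lambda>w. (g (\<theta> (\<sigma> z w)) - g (\<theta> z)) + f z)"
      by (simp add: f_def)
    also have "\<dots> \<le> H2_norm (\<lambda>w. g (\<theta> (\<sigma> z w)) - g (\<theta> z)) + ennreal (cmod (f z))"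
      by (rule H2_norm_add_const[OF c])
    also have "\<dots> \<le> ennreal M + ennreal (3 * M * (1 / 2))"
      using H2_norm_compose_le_bmoa_seminorm[OF g \<theta>z] M(1) f_le[OF z] half
      by (intro add_mono ennreal_leI) auto
    also have "\<dots> = ennreal (cmod (complex_of_real (5 * M) * \<psi> z))"
      using M(2) half by (subst ennreal_plus[symmetric]) (auto simp: norm_mult)
    finally show "H2_norm (\<lambda>w. f (\<sigma> z w)) \<le> ennreal (cmod (complex_of_real (5 * M) * \<psi> z))" .
  qed (use f \<psi>(2) in auto)
  also have "\<dots> = ennreal (5 * M) * H2_norm \<psi>"
    using M(2) by (simp add: H2_norm_cmult[of "complex_of_real (5 * M)" \<psi>, simplified])
  finally show ?thesis by (simp add: f_def \<psi>_def b_def)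
qed

text \<open>
  The oscillation of \<open>g \<circ> \<phi>\<close> at \<open>b\<close> is at most \<open>5 M \<epsilon>\<close> when \<open>\<bar>\<phi> b\<bar> \<ge> R\<close>, by the preceding theorem.  When
  \<open>\<bar>\<phi> b\<bar> < R\<close>, start at \<open>b\<close> and stop when \<open>\<bar>\<phi>\<bar>\<close> first reaches \<open>R\<close>: until then \<open>\<bar>g \<circ> \<phi>\<bar> \<le> \<delta>\<close>, and afterwards
  the oscillation is again at most \<open>5 M \<epsilon>\<close>.
\<close>

theorem bmoa_seminorm_compose_small:
  assumes g: "g holomorphic_on \<bbbD>" and M: "bmoa_seminorm g \<le> ennreal M" "M > 0"
    and \<phi>: "\<phi> holomorphic_on \<bbbD>" "\<phi> ` \<bbbD> \<subseteq> \<bbbD>"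
    and R: "R < 1" and \<delta>: "\<And>w. cmod w \<le> R \<Longrightarrow> cmod (g w) \<le> \<delta>" "\<delta> \<ge> 0"
    and \<epsilon>: "\<And>a. a \<in> \<bbbD> \<Longrightarrow> R \<le> cmod a \<Longrightarrow> bmoa_seminorm (\<lambda>z. \<sigma> a (\<phi> z)) \<le> ennreal \<epsilon>" "\<epsilon> \<ge> 0"
  shows "bmoa_seminorm (\<lambda>z. g (\<phi> z)) \<le> ennreal (5 * M * \<epsilon> + 2 * \<delta>)"
  unfolding bmoa_seminorm_def[of "\<lambda>z. g (\<phi> z)"]
proof (intro SUP_least)
  define B where "B = 5 * M * \<epsilon>"
  have B: "B \<ge> 0" using M(2) \<epsilon>(2) by (simp add: B_def)
  \<comment> \<open>applied to \<open>\<sigma> b\<close> when \<open>\<bar>\<phi> b\<bar> \<ge> R\<close>, and to \<open>\<sigma> b \<circ> \<sigma> z\<close> at a stopping point \<open>z\<close>\<close>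
  have outer: "H2_norm (\<lambda>z. g (\<phi> (\<gamma> z)) - g (\<phi> (\<gamma> 0))) \<le> ennreal B"
    if \<gamma>: "\<gamma> holomorphic_on \<bbbD>" "\<gamma> ` \<bbbD> \<subseteq> \<bbbD>" and far: "R \<le> cmod (\<phi> (\<gamma> 0))" for \<gamma>
  proof -
    define a where "a = \<phi> (\<gamma> 0)"
    have a: "a \<in> \<bbbD>" "R \<le> cmod a"
      using \<phi>(2) \<gamma>(2) far by (auto simp: a_def image_subset_iff)
    have \<phi>\<gamma>: "(\<lambda>z. \<phi> (\<gamma> z)) holomorphic_on \<bbbD>" "(\<lambda>z. \<phi> (\<gamma> z)) ` \<bbbD> \<subseteq> \<bbbD>"
      using holomorphic_on_disc_compose[OF \<phi>(1) \<gamma>] \<phi>(2) \<gamma>(2) by (auto simp: image_subset_iff)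
    have "H2_norm (\<lambda>z. \<sigma> a (\<phi> (\<gamma> z)) - \<sigma> a (\<phi> (\<gamma> 0))) \<le> bmoa_seminorm (\<lambda>z. \<sigma> a (\<phi> z))"
      by (intro H2_norm_compose_le_bmoa_seminorm[OF _ \<gamma>]
          holomorphic_on_disc_compose[OF disc_aut_holomorphic[OF a(1)] \<phi>])
    also have "\<dots> \<le> ennreal \<epsilon>"
      by (intro \<epsilon> a)
    finally have "H2_norm (\<lambda>z. \<sigma> a (\<phi> (\<gamma> z))) \<le> ennreal \<epsilon>"
      by (simp flip: a_def)
    then have "ennreal (5 * M) * H2_norm (\<lambda>z. \<sigma> a (\<phi> (\<gamma> z))) \<le> ennreal (5 * M) * ennreal \<epsilon>"
      by (intro mult_left_mono) auto
    also have "\<dots> = ennreal B"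
      using M(2) \<epsilon>(2) by (simp add: B_def ennreal_mult')
    finally show ?thesis
      using H2_norm_compose_le_disc_aut[OF g M \<phi>\<gamma>] by (auto simp flip: a_def intro: order.trans)
  qed
  fix b assume b: "b \<in> \<bbbD>"
  have autb: "\<sigma> b holomorphic_on \<bbbD>" "\<sigma> b ` \<bbbD> \<subseteq> \<bbbD>"
    using disc_aut_holomorphic[OF b] disc_aut_in_disc[OF b] by auto
  show "H2_norm (\<lambda>z. g (\<phi> (\<sigma> b z)) - g (\<phi> b)) \<le> ennreal (5 * M * \<epsilon> + 2 * \<delta>)"
  proof (cases "R \<le> cmod (\<phi> b)")
    case True
    then have "H2_norm (\<lambda>z. g (\<phi> (\<sigma> b z)) - g (\<phi> b)) \<le> ennreal B"
      using outer[OF autb] by simp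
    also have "\<dots> \<le> ennreal (5 * M * \<epsilon> + 2 * \<delta>)"
      using \<delta>(2) by (intro ennreal_leI) (simp add: B_def)
    finally show ?thesis .
  next
    case False
    define \<theta> where "\<theta> = (\<lambda>z. \<phi> (\<sigma> b z))"
    have \<theta>: "\<theta> holomorphic_on \<bbbD>" "\<theta> ` \<bbbD> \<subseteq> \<bbbD>"
      using holomorphic_on_disc_compose[OF \<phi>(1) autb] \<phi>(2) autb(2)
      by (auto simp: image_subset_iff \<theta>_def)
    have g\<theta>: "(\<lambda>z. g (\<theta> z)) holomorphic_on \<bbbD>"
      by (rule holomorphic_on_disc_compose[OF g \<theta>])
    have "H2_norm (\<lambda>z. g (\<theta> z)) \<le> H2_norm (\<lambda>z. complex_of_real (B + \<delta>))"
    proof (rule H2_norm_le_by_stopping[where \<tau> = \<theta> and \<rho> = R])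
      show "continuous_on \<bbbD> \<theta>"
        by (intro holomorphic_on_imp_continuous_on \<theta>)
      fix z assume z: "z \<in> \<bbbD>"
      show "cmod (g (\<theta> z)) \<le> cmod (complex_of_real (B + \<delta>))" if "cmod (\<theta> z) \<le> R"
        using \<delta>(1)[OF that] B \<delta>(2) by (simp only: norm_of_real)
      assume eq: "cmod (\<theta> z) = R"
      have autz: "\<sigma> z holomorphic_on \<bbbD>" "\<sigma> z ` \<bbbD> \<subseteq> \<bbbD>"
        using disc_aut_holomorphic[OF z] disc_aut_in_disc[OF z] by auto
      have bz: "(\<lambda>w. \<sigma> b (\<sigma> z w)) holomorphic_on \<bbbD>" "(\<lambda>w. \<sigma> b (\<sigma> z w)) ` \<bbbD> \<subseteq> \<bbbD>"
        using holomorphic_on_disc_compose[OF autb(1) autz] autb(2) autz(2)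
        by (auto simp: image_subset_iff)
      have c: "continuous_on \<bbbD> (\<lambda>w. g (\<theta> (\<sigma> z w)) - g (\<theta> z))"
        by (intro continuous_intros holomorphic_on_imp_continuous_on
            holomorphic_on_disc_compose[OF g\<theta> autz])
      have "H2_norm (\<lambda>w. g (\<theta> (\<sigma> z w))) = H2_norm (\<lambda>w. (g (\<theta> (\<sigma> z w)) - g (\<theta> z)) + g (\<theta> z))"
        by simp
      also have "\<dots> \<le> H2_norm (\<lambda>w. g (\<theta> (\<sigma> z w)) - g (\<theta> z)) + ennreal (cmod (g (\<theta> z)))"
        by (rule H2_norm_add_const[OF c])
      also have "\<dots> \<le> ennreal B + ennreal \<delta>"
        using outer[OF bz] eq \<delta>(1)[of "\<theta> z"] by (intro add_mono ennreal_leI) (auto simp: \<theta>_def)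
      also have "\<dots> = ennreal (cmod (complex_of_real (B + \<delta>)))"
        using B \<delta>(2) by (simp only: norm_of_real) simp
      finally show "H2_norm (\<lambda>w. g (\<theta> (\<sigma> z w))) \<le> ennreal (cmod (complex_of_real (B + \<delta>)))" .
    qed (use False g\<theta> in \<open>auto simp: \<theta>_def\<close>)
    then have le: "H2_norm (\<lambda>z. g (\<theta> z)) \<le> ennreal (B + \<delta>)"
      using B \<delta>(2) by (simp only: H2_norm_const norm_of_real) simp
    have "H2_norm (\<lambda>z. g (\<theta> z) + - g (\<phi> b)) \<le> H2_norm (\<lambda>z. g (\<theta> z)) + ennreal (cmod (- g (\<phi> b)))"
      by (intro H2_norm_add_const holomorphic_on_imp_continuous_on g\<theta>)
    also have "\<dots> \<le> ennreal (B + \<delta>) + ennreal \<delta>"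
      using \<delta>(1)[of "\<phi> b"] False by (intro add_mono le ennreal_leI) auto
    also have "\<dots> = ennreal (5 * M * \<epsilon> + 2 * \<delta>)"
      using B \<delta>(2) by (subst ennreal_plus[symmetric]) (auto simp: B_def)
    finally show ?thesis by (simp add: \<theta>_def)
  qed
qed

section \<open>Normal families in BMOA\<close>

lemma H2_mean_le_bound:
  assumes f: "continuous_on \<bbbD> f" and r: "r \<in> {0..<1}" and c: "\<And>z. cmod z = r \<Longrightarrow> cmod (f z) \<le> c" "c \<ge> 0"
  shows "H2_mean f r \<le> c"
proof -
  have "circle_mean (\<lambda>z. (cmod (f z))\<^sup>2) r \<le> circle_mean (\<lambda>z. c\<^sup>2) r"
    using r c by (intro circle_mean_mono continuous_intros f power_mono) auto
  also have "\<dots> = c\<^sup>2"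
    by (simp add: circle_mean_def)
  finally show ?thesis
    using c(2) by (simp add: H2_mean_eq real_le_lsqrt)
qed

lemma bmoa_seminorm_bounded:
  assumes f: "f holomorphic_on \<bbbD>" and c: "\<And>z. z \<in> \<bbbD> \<Longrightarrow> cmod (f z) \<le> c" "c \<ge> 0"
  shows "bmoa_seminorm f \<le> ennreal (2 * c)"
  unfolding bmoa_seminorm_def
proof (intro SUP_least H2_norm_leI H2_mean_le_bound)
  fix a r z assume a: "a \<in> \<bbbD>" and "r \<in> {0..<1::real}" "cmod z = r"
  then have "cmod (f (\<sigma> a z)) \<le> c" "cmod (f a) \<le> c"
    using disc_aut_in_disc[OF a, of z] by (auto intro!: c)
  then show "cmod (f (\<sigma> a z) - f a) \<le> 2 * c"
    using norm_triangle_ineq4[of "f (\<sigma> a z)" "f a"] by linarith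
qed (use c continuous_on_disc_aut_diff[OF f] in auto)

lemma bmoa_seminorm_cong:
  assumes "\<And>z. z \<in> \<bbbD> \<Longrightarrow> f z = g z"
  shows "bmoa_seminorm f = bmoa_seminorm g"
  unfolding bmoa_seminorm_def
proof (rule SUP_cong)
  fix a assume "a \<in> \<bbbD>"
  then show "H2_norm (\<lambda>z. f (\<sigma> a z) - f a) = H2_norm (\<lambda>z. g (\<sigma> a z) - g a)"
    using assms disc_aut_in_disc by (intro H2_norm_cong) simp
qed simp

lemma bmoa_seminorm_restrict: "bmoa_seminorm (restrict f \<bbbD>) = bmoa_seminorm f"
  by (rule bmoa_seminorm_cong) simp

lemma bmoa_seminorm_cmult: "bmoa_seminorm (\<lambda>z. c * f z) = ennreal (cmod c) * bmoa_seminorm f"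
  by (simp add: bmoa_seminorm_def SUP_mult_left_ennreal H2_norm_cmult flip: right_diff_distrib)

lemma norm_diff_le_bmoa_seminorm:
  assumes f: "f holomorphic_on \<bbbD>" and M: "bmoa_seminorm f \<le> ennreal M" "M \<ge> 0" and z: "z \<in> \<bbbD>"
  shows "(cmod (f z - f 0))\<^sup>2 * (1 - cmod z) \<le> M\<^sup>2"
proof (rule norm_le_H2_norm)
  show "(\<lambda>z. f z - f 0) holomorphic_on \<bbbD>"
    by (intro holomorphic_intros f)
  show "H2_norm (\<lambda>z. f z - f 0) \<le> ennreal M"
    using H2_norm_compose_le_bmoa_seminorm[OF f holomorphic_on_ident] M(1) by simp
qed (use M z in auto)

text \<open>
  Lower semicontinuity of the seminorm, needed to see that the limits given by Montel's theorem stay in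
  \<open>BMOA\<close>.
\<close>

lemma bmoa_seminorm_le_limit:
  fixes F :: "nat \<Rightarrow> complex \<Rightarrow> complex"
  assumes F: "\<And>n. F n holomorphic_on \<bbbD>" and f: "f holomorphic_on \<bbbD>"
    and lim: "\<And>K. compact K \<Longrightarrow> K \<subseteq> \<bbbD> \<Longrightarrow> uniform_limit K F f sequentially"
    and M: "\<And>n. bmoa_seminorm (F n) \<le> ennreal M" "M \<ge> 0"
  shows "bmoa_seminorm f \<le> ennreal M"
  unfolding bmoa_seminorm_def
proof (intro SUP_least H2_norm_leI)
  fix a r assume a: "a \<in> \<bbbD>" and r: "r \<in> {0..<1::real}"
  define K where "K = \<sigma> a ` cball 0 r"
  have rD: "cball 0 r \<subseteq> \<bbbD>" using r by auto
  have K: "compact K" "K \<subseteq> \<bbbD>"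
    unfolding K_def using rD disc_aut_in_disc[OF a]
    by (auto intro!: compact_continuous_image holomorphic_on_imp_continuous_on
        holomorphic_on_subset[OF disc_aut_holomorphic[OF a]])
  have aK: "a \<in> K"
    unfolding K_def using r by (intro image_eqI[of _ _ 0]) auto
  show "H2_mean (\<lambda>z. f (\<sigma> a z) - f a) r \<le> M"
  proof (rule field_le_epsilon)
    fix e :: real assume e: "e > 0"
    obtain n where n: "\<And>x. x \<in> K \<Longrightarrow> dist (F n x) (f x) < e / 2"
      using lim[OF K] e unfolding uniform_limit_iff eventually_sequentially
      by (meson half_gt_zero order_refl)
    define d where "d = (\<lambda>z. f z - F n z)"
    have cd: "continuous_on \<bbbD> (\<lambda>z. d (\<sigma> a z) - d a)" and cF: "continuous_on \<bbbD> (\<lambda>z. F n (\<sigma> a z) - F n a)"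
      by (intro continuous_on_disc_aut_diff a F f holomorphic_intros | simp add: d_def)+
    have "H2_mean (\<lambda>z. f (\<sigma> a z) - f a) r = H2_mean (\<lambda>z. (F n (\<sigma> a z) - F n a) + (d (\<sigma> a z) - d a)) r"
      by (simp add: d_def algebra_simps)
    also have "\<dots> \<le> H2_mean (\<lambda>z. F n (\<sigma> a z) - F n a) r + H2_mean (\<lambda>z. d (\<sigma> a z) - d a) r"
      by (intro H2_mean_triangle cd cF r)
    also have "H2_mean (\<lambda>z. F n (\<sigma> a z) - F n a) r \<le> M"
    proof (rule H2_mean_leD[OF _ M(2) r])
      have "H2_norm (\<lambda>z. F n (\<sigma> a z) - F n a) \<le> bmoa_seminorm (F n)"
        unfolding bmoa_seminorm_def by (intro SUP_upper a)
      with M(1)[of n] show "H2_norm (\<lambda>z. F n (\<sigma> a z) - F n a) \<le> ennreal M" by simp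
    qed
    also have "H2_mean (\<lambda>z. d (\<sigma> a z) - d a) r \<le> e"
    proof (rule H2_mean_le_bound[OF cd r])
      fix z :: complex assume z: "cmod z = r"
      have "cmod (d (\<sigma> a z)) < e / 2" "cmod (d a) < e / 2"
        using n[of "\<sigma> a z"] n[OF aK] z by (auto simp: K_def d_def dist_norm norm_minus_commute)
      then show "cmod (d (\<sigma> a z) - d a) \<le> e"
        using norm_triangle_ineq4[of "d (\<sigma> a z)" "d a"] by linarith
    qed (use e in simp)
    finally show "H2_mean (\<lambda>z. f (\<sigma> a z) - f a) r \<le> M + e" by simp
  qed
qed

lemma eventually_near_unit_circle:
  "eventually P (filtercomap cmod (at_left 1)) \<longleftrightarrow> (\<exists>R<1. \<forall>a. R < cmod a \<and> cmod a < 1 \<longrightarrow> P a)"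
  unfolding eventually_filtercomap eventually_at_left_field
proof safe
  fix R :: real assume "R < 1" and P: "\<forall>a. R < cmod a \<and> cmod a < 1 \<longrightarrow> P a"
  then show "\<exists>Q. (\<exists>b<1. \<forall>y>b. y < 1 \<longrightarrow> Q y) \<and> (\<forall>x. Q (cmod x) \<longrightarrow> P x)"
    by (intro exI[of _ "\<lambda>y. R < y \<and> y < 1"]) auto
qed blast

lemma bmoa_norm_le_1D:
  assumes "f \<in> BMOA" "bmoa_norm f \<le> 1"
  shows "cmod (f 0) \<le> 1" "bmoa_seminorm f \<le> ennreal 1"
proof -
  have "enn2real (bmoa_seminorm f) \<le> 1" "cmod (f 0) \<le> 1"
    using assms(2) enn2real_nonneg[of "bmoa_seminorm f"] norm_ge_zero[of "f 0"]
    unfolding bmoa_norm_def by linarith+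
  then show "cmod (f 0) \<le> 1" "bmoa_seminorm f \<le> ennreal 1"
    using assms(1) by (auto simp: BMOA_def)
qed

lemma composition_op_in_BMOA:
  assumes \<phi>: "\<phi> holomorphic_on \<bbbD>" "\<phi> ` \<bbbD> \<subseteq> \<bbbD>" and f: "f \<in> BMOA"
  shows "composition_op \<phi> f \<in> BMOA"
proof -
  have fhol: "f holomorphic_on \<bbbD>" using f by (simp add: BMOA_def)
  have "composition_op \<phi> f holomorphic_on \<bbbD>"
    using holomorphic_on_disc_compose[OF fhol \<phi>]
    by (rule holomorphic_transform) (simp add: composition_op_def)
  moreover have "bmoa_seminorm (composition_op \<phi> f) = bmoa_seminorm (\<lambda>z. f (\<phi> z))"
    by (intro bmoa_seminorm_cong) (simp add: composition_op_def)
  moreover have "\<dots> \<le> bmoa_seminorm f"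
    by (rule bmoa_seminorm_compose_le[OF fhol \<phi>])
  ultimately show ?thesis
    using f by (auto simp: BMOA_def composition_op_def)
qed

text \<open>
  The growth estimate makes the unit ball of \<open>BMOA\<close> locally bounded, so that Montel's theorem applies.
\<close>

lemma BMOA_ball_normal:
  fixes F :: "nat \<Rightarrow> complex \<Rightarrow> complex"
  assumes F: "\<And>n. F n \<in> BMOA" "\<And>n. bmoa_norm (F n) \<le> 1"
  obtains f r where "f \<in> BMOA" "strict_mono r" "bmoa_seminorm f \<le> ennreal 1"
    "\<And>K. compact K \<Longrightarrow> K \<subseteq> \<bbbD> \<Longrightarrow> uniform_limit K (\<lambda>n. F (r n)) f sequentially"
proof -
  define \<H> where "\<H> = {f \<in> BMOA. bmoa_norm f \<le> 1}"
  have hol: "h holomorphic_on \<bbbD>" if "h \<in> \<H>" for h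
    using that by (simp add: \<H>_def BMOA_def)
  have bounded: "\<exists>B. \<forall>h\<in>\<H>. \<forall>z\<in>K. cmod (h z) \<le> B" if K: "compact K" "K \<subseteq> \<bbbD>" for K
  proof (cases "K = {}")
    case False
    obtain x where x: "x \<in> K" "\<And>z. z \<in> K \<Longrightarrow> cmod z \<le> cmod x"
      using continuous_attains_sup[OF K(1) False, of cmod] by (auto intro: continuous_intros)
    have x1: "cmod x < 1" using x(1) K(2) by auto
    show ?thesis
    proof (intro exI[of _ "1 + sqrt (1 / (1 - cmod x))"] ballI)
      fix h z assume h: "h \<in> \<H>" and z: "z \<in> K"
      have h1: "cmod (h 0) \<le> 1" "bmoa_seminorm h \<le> ennreal 1"
        using h bmoa_norm_le_1D by (auto simp: \<H>_def)
      have "(cmod (h z - h 0))\<^sup>2 * (1 - cmod x) \<le> (cmod (h z - h 0))\<^sup>2 * (1 - cmod z)"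
        using x(2)[OF z] by (intro mult_left_mono) auto
      also have "\<dots> \<le> 1"
        using norm_diff_le_bmoa_seminorm[OF hol[OF h] h1(2)] z K(2) by auto
      finally have "cmod (h z - h 0) \<le> sqrt (1 / (1 - cmod x))"
        using x1 by (intro real_le_rsqrt) (simp add: field_simps)
      then show "cmod (h z) \<le> 1 + sqrt (1 / (1 - cmod x))"
        using h1(1) norm_triangle_ineq2[of "h z" "h 0"] by linarith
    qed
  qed simp
  have rng: "range F \<subseteq> \<H>" using F by (auto simp: \<H>_def)
  obtain g r where g: "g holomorphic_on \<bbbD>" and r: "strict_mono (r :: nat \<Rightarrow> nat)"
    and lim: "\<And>K. compact K \<Longrightarrow> K \<subseteq> \<bbbD> \<Longrightarrow> uniform_limit K (F \<circ> r) g sequentially"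
    by (rule Montel[OF open_ball hol bounded rng]) (assumption+, rule that)
  have g1: "bmoa_seminorm g \<le> ennreal 1"
  proof (rule bmoa_seminorm_le_limit[OF _ g lim])
    show "(F \<circ> r) n holomorphic_on \<bbbD>" "bmoa_seminorm ((F \<circ> r) n) \<le> ennreal 1" for n
      using F[of "r n"] bmoa_norm_le_1D[of "F (r n)"] by (auto simp: BMOA_def)
  qed auto
  have f1: "bmoa_seminorm (restrict g \<bbbD>) \<le> ennreal 1"
    using g1 by (simp add: bmoa_seminorm_restrict)
  moreover have "restrict g \<bbbD> holomorphic_on \<bbbD>"
    using g by (rule holomorphic_transform) simp
  ultimately have "restrict g \<bbbD> \<in> BMOA"
    by (auto simp: BMOA_def intro: le_less_trans)
  moreover have "uniform_limit K (\<lambda>n. F (r n)) (restrict g \<bbbD>) sequentially"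
    if "compact K" "K \<subseteq> \<bbbD>" for K
    using lim[OF that] that(2) by (subst uniform_limit_cong'[where g = "F \<circ> r" and i = g]) auto
  ultimately show ?thesis
    by (intro that[of "restrict g \<bbbD>" r] r f1)
qed

section \<open>Compactness\<close>

text \<open>
  From a sequence in the unit ball choose a subsequence converging locally uniformly to some \<open>f\<close>, and let
  \<open>g\<close> be the difference of one of its members and \<open>f\<close>.  Then \<open>g\<close> has seminorm at most \<open>2\<close> and is small
  on any given compact set from some index on, so that \<open>g \<circ> \<phi>\<close> is small in \<open>BMOA\<close>.
\<close>

lemma compact_if_bmoa_seminorm_vanishes:
  assumes \<phi>: "\<phi> holomorphic_on \<bbbD>" "\<phi> ` \<bbbD> \<subseteq> \<bbbD>"
    and lim: "((\<lambda>a. bmoa_seminorm (\<sigma> a \<circ> \<phi>)) \<longlongrightarrow> 0) (filtercomap cmod (at_left 1))"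
  shows "compact_on_BMOA (composition_op \<phi>)"
  unfolding compact_on_BMOA_def
proof
  let ?T = "composition_op \<phi>" and ?B = "{f \<in> BMOA. bmoa_norm f \<le> 1}"
  show T: "?T ` BMOA \<subseteq> BMOA"
    using composition_op_in_BMOA[OF \<phi>] by blast
  have "\<exists>l r. l \<in> BMOA \<and> strict_mono r \<and> limitin BMOA.mtopology (s \<circ> r) l sequentially"
    if s: "range s \<subseteq> ?T ` ?B" for s :: "nat \<Rightarrow> complex \<Rightarrow> complex"
  proof -
    have "\<exists>f. f \<in> ?B \<and> s n = ?T f" for n using s by blast
    then obtain F where "\<And>n. F n \<in> ?B \<and> s n = ?T (F n)" by metis
    then have F: "F n \<in> BMOA" "bmoa_norm (F n) \<le> 1" "s n = ?T (F n)" for n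
      by auto
    obtain f r where f: "f \<in> BMOA" "bmoa_seminorm f \<le> ennreal 1" and r: "strict_mono r"
      and ul: "\<And>K. compact K \<Longrightarrow> K \<subseteq> \<bbbD> \<Longrightarrow> uniform_limit K (\<lambda>n. F (r n)) f sequentially"
      by (rule BMOA_ball_normal[of F, OF F(1,2)]) (rule that)
    have "limitin BMOA.mtopology (s \<circ> r) (?T f) sequentially"
      unfolding BMOA.limitin_metric
    proof (intro conjI allI impI)
      show Tf: "?T f \<in> BMOA" using T f(1) by blast
      fix e :: real assume e: "e > 0"
      \<comment> \<open>With tolerances \<open>e / 40\<close> and \<open>e / 8\<close> the norm is at most \<open>e / 8 + (10 e / 40 + 2 e / 8) < e\<close>.\<close>
      have "\<forall>\<^sub>F a in filtercomap cmod (at_left 1). bmoa_seminorm (\<sigma> a \<circ> \<phi>) < ennreal (e / 40)"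
        using e by (intro order_tendstoD(2)[OF lim]) auto
      then obtain R0 where R0: "R0 < 1"
        "\<And>a. R0 < cmod a \<Longrightarrow> cmod a < 1 \<Longrightarrow> bmoa_seminorm (\<sigma> a \<circ> \<phi>) < ennreal (e / 40)"
        by (auto simp: eventually_near_unit_circle)
      \<comment> \<open>The maximum with \<open>\<bar>\<phi> 0\<bar>\<close> makes \<open>g (\<phi> 0)\<close> small, which the norm of \<open>BMOA\<close> requires too.\<close>
      define R where "R = max ((R0 + 1) / 2) (cmod (\<phi> 0))"
      have R: "R < 1" "R0 < R" "cmod (\<phi> 0) \<le> R"
        using R0(1) \<phi>(2) by (auto simp: R_def image_subset_iff less_max_iff_disj)
      have "\<forall>\<^sub>F n in sequentially. \<forall>w\<in>cball 0 R. dist (F (r n) w) (f w) < e / 8"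
        using R(1) e by (intro uniform_limitD[OF ul]) auto
      then show "\<forall>\<^sub>F n in sequentially. (s \<circ> r) n \<in> BMOA \<and> bmoa_dist ((s \<circ> r) n) (?T f) < e"
      proof eventually_elim
        case (elim n)
        define g where "g = (\<lambda>z. F (r n) z - f z)"
        have hols: "F (r n) holomorphic_on \<bbbD>" "f holomorphic_on \<bbbD>"
          using F(1)[of "r n"] f(1) by (auto simp: BMOA_def)
        then have g: "g holomorphic_on \<bbbD>"
          by (auto simp: g_def intro!: holomorphic_intros)
        have small: "cmod (g w) \<le> e / 8" if "cmod w \<le> R" for w
          using elim that by (auto simp: g_def dist_norm intro: less_imp_le)
        have "bmoa_seminorm (\<lambda>z. F (r n) z + - f z)
            \<le> bmoa_seminorm (F (r n)) + bmoa_seminorm (\<lambda>z. - f z)"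
          by (intro bmoa_seminorm_triangle holomorphic_intros hols)
        also have "\<dots> \<le> ennreal 1 + ennreal 1"
          using f(2) bmoa_norm_le_1D(2)[OF F(1,2)] by (intro add_mono) (auto simp: bmoa_seminorm_uminus)
        also have "\<dots> = ennreal 2"
          by (subst ennreal_plus[symmetric]) auto
        finally have g2: "bmoa_seminorm g \<le> ennreal 2"
          by (simp add: g_def)
        have "bmoa_seminorm (\<lambda>z. g (\<phi> z)) \<le> ennreal (5 * 2 * (e / 40) + 2 * (e / 8))"
        proof (rule bmoa_seminorm_compose_small[OF g g2 _ \<phi> R(1) small])
          fix a :: complex assume "a \<in> \<bbbD>" "R \<le> cmod a"
          then show "bmoa_seminorm (\<lambda>z. \<sigma> a (\<phi> z)) \<le> ennreal (e / 40)"
            using R0(2)[of a] R(2) by (simp add: o_def less_imp_le)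
        qed (use e in auto)
        then have le: "enn2real (bmoa_seminorm (\<lambda>z. g (\<phi> z))) \<le> e / 2"
          using e by (intro enn2real_leI) auto
        have "bmoa_seminorm (\<lambda>z. ?T (F (r n)) z - ?T f z) = bmoa_seminorm (\<lambda>z. g (\<phi> z))"
          by (intro bmoa_seminorm_cong) (simp add: composition_op_def g_def)
        then have "bmoa_dist ((s \<circ> r) n) (?T f) \<le> e / 8 + e / 2"
          using le small[OF R(3)]
          by (simp add: bmoa_dist_def bmoa_norm_def F(3) composition_op_def g_def)
        then show ?case
          using e T F(1)[of "r n"] by (auto simp: F(3))
      qed
    qed
    then show ?thesis using r T f(1) by blast
  qed
  then have "\<forall>U. U \<subseteq> ?T ` ?B \<and> infinite U \<longrightarrow> BMOA \<inter> BMOA.mtopology derived_set_of U \<noteq> {}"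
    using T by (intro BMOA.Bolzano_Weierstrass_property[THEN iffD1]) blast+
  then show "compactin BMOA.mtopology (BMOA.mtopology closure_of (?T ` ?B))"
    unfolding BMOA.compact_closure_of_eq_Bolzano_Weierstrass by blast
qed

text \<open>
  As \<open>\<bar>a\<bar> \<rightarrow> 1\<close>, the automorphisms \<open>\<sigma> a\<close> become constant on compact sets.
\<close>

lemma norm_disc_aut_diff_le:
  assumes a: "a \<in> \<bbbD>" and w: "w \<in> \<bbbD>"
  shows "cmod (\<sigma> a w - a) \<le> (1 - (cmod a)\<^sup>2) / (1 - cmod w)"
proof -
  have le: "1 - cmod w \<le> cmod (1 - cnj a * w)"
  proof -
    have "cmod (cnj a * w) \<le> 1 * cmod w"
      using a unfolding norm_mult by (intro mult_right_mono) auto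
    then show ?thesis
      using norm_triangle_ineq2[of 1 "cnj a * w"] by simp
  qed
  then have "1 - cnj a * w \<noteq> 0" using w by auto
  moreover have "cnj a * a = (cmod a)\<^sup>2"
    by (metis complex_norm_square mult.commute of_real_power)
  ultimately have "\<sigma> a w - a = - w * of_real (1 - (cmod a)\<^sup>2) / (1 - cnj a * w)"
    by (simp add: disc_aut_def field_simps)
  moreover have "(cmod a)\<^sup>2 \<le> 1"
    using a by (simp add: power_le_one)
  ultimately have "cmod (\<sigma> a w - a) = cmod w * (1 - (cmod a)\<^sup>2) / cmod (1 - cnj a * w)"
    by (simp only: norm_divide norm_mult norm_minus_cancel norm_of_real)
  also have "\<dots> \<le> 1 * (1 - (cmod a)\<^sup>2) / (1 - cmod w)"
    using le w \<open>(cmod a)\<^sup>2 \<le> 1\<close> by (intro frac_le mult_right_mono) auto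
  finally show ?thesis by simp
qed

text \<open>
  The functions \<open>\<sigma> a / 4\<close> lie in the unit ball of \<open>BMOA\<close>: they are at most \<open>1 / 4\<close> at \<open>0\<close>, and
  their seminorm is at most twice their supremum.  If the seminorms did not tend to \<open>0\<close>, a
  compact operator would yield points \<open>a\<close> approaching the circle, with seminorms bounded below, along which
  \<open>\<sigma> a \<circ> \<phi> / 4\<close> converges in \<open>BMOA\<close>.  The limit must be constant, because \<open>\<sigma> a - a\<close> tends to \<open>0\<close>
  pointwise; and constants are invisible to the seminorm.
\<close>

lemma bmoa_seminorm_vanishes_if_compact:
  assumes \<phi>: "\<phi> holomorphic_on \<bbbD>" "\<phi> ` \<bbbD> \<subseteq> \<bbbD>"
    and compact: "compact_on_BMOA (composition_op \<phi>)"
  shows "((\<lambda>a. bmoa_seminorm (\<sigma> a \<circ> \<phi>)) \<longlongrightarrow> 0) (filtercomap cmod (at_left 1))"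
proof (rule order_tendstoI)
  fix e :: ennreal assume "0 < e"
  let ?T = "composition_op \<phi>" and ?B = "{f \<in> BMOA. bmoa_norm f \<le> 1}"
  have T: "?T ` BMOA \<subseteq> BMOA"
    and K: "compactin BMOA.mtopology (BMOA.mtopology closure_of (?T ` ?B))"
    using compact by (auto simp: compact_on_BMOA_def)
  show "\<forall>\<^sub>F a in filtercomap cmod (at_left 1). bmoa_seminorm (\<sigma> a \<circ> \<phi>) < e"
  proof (rule ccontr)
    assume "\<not> ?thesis"
    then have "\<exists>a. R < cmod a \<and> cmod a < 1 \<and> e \<le> bmoa_seminorm (\<sigma> a \<circ> \<phi>)" if "R < 1" for R
      using that unfolding eventually_near_unit_circle by (meson not_less)
    then have "\<exists>a. 1 - inverse (of_nat (Suc n)) < cmod a \<and> cmod a < 1 \<and> e \<le> bmoa_seminorm (\<sigma> a \<circ> \<phi>)" for n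
      by simp
    then obtain a where a: "\<And>n. 1 - inverse (of_nat (Suc n)) < cmod (a n)" "\<And>n. cmod (a n) < 1"
      "\<And>n. e \<le> bmoa_seminorm (\<sigma> (a n) \<circ> \<phi>)"
      by metis
    have aD: "a n \<in> \<bbbD>" for n using a(2) by simp
    have a_lim: "(\<lambda>n. cmod (a n)) \<longlonglongrightarrow> 1"
    proof (rule tendsto_sandwich)
      show "(\<lambda>n. 1 - inverse (real (Suc n))) \<longlonglongrightarrow> 1"
        using tendsto_diff[OF tendsto_const[of 1] LIMSEQ_inverse_real_of_nat] by simp
    qed (use a in \<open>auto intro!: always_eventually less_imp_le\<close>)
    define F where "F = (\<lambda>n. restrict (\<lambda>z. of_real (1 / 4) * \<sigma> (a n) z) \<bbbD>)"
    have F: "F n \<in> ?B" for n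
    proof -
      have hol: "(\<lambda>z. of_real (1 / 4) * \<sigma> (a n) z) holomorphic_on \<bbbD>"
        by (intro holomorphic_intros disc_aut_holomorphic aD)
      have "bmoa_seminorm (\<lambda>z. of_real (1 / 4) * \<sigma> (a n) z) \<le> ennreal (2 * (1 / 4))"
        using disc_aut_in_disc[OF aD[of n]]
        by (intro bmoa_seminorm_bounded hol) (auto simp: norm_mult less_imp_le)
      then have sem: "bmoa_seminorm (F n) \<le> ennreal (1 / 2)"
        by (simp add: F_def bmoa_seminorm_restrict)
      have "F n holomorphic_on \<bbbD>"
        using hol by (rule holomorphic_transform) (simp add: F_def)
      then have "F n \<in> BMOA"
        using le_less_trans[OF sem ennreal_less_top] by (auto simp: BMOA_def F_def)
      moreover have "enn2real (bmoa_seminorm (F n)) \<le> 1 / 2"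
        using sem by (intro enn2real_leI) auto
      moreover have "cmod (F n 0) \<le> 1 / 2"
        using a(2)[of n] by (simp add: F_def norm_mult)
      ultimately show ?thesis by (simp add: bmoa_norm_def)
    qed
    have "range (\<lambda>n. ?T (F n)) \<subseteq> ?T ` ?B"
      using F by blast
    also have "\<dots> \<subseteq> BMOA.mtopology closure_of (?T ` ?B)"
      using T by (intro closure_of_subset) auto
    finally have "range (\<lambda>n. ?T (F n)) \<subseteq> BMOA.mtopology closure_of (?T ` ?B)" .
    from K[unfolded BMOA.compactin_sequentially, THEN conjunct2, rule_format, OF this]
    obtain l r where r: "strict_mono r"
      and lim: "limitin BMOA.mtopology ((\<lambda>n. ?T (F n)) \<circ> r) l sequentially"
      by (elim exE conjE) (rule that)
    define G where "G = (\<lambda>n. ?T (F (r n)))"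
    have l: "l \<in> BMOA" and lim: "\<And>\<epsilon>. \<epsilon> > 0 \<Longrightarrow> \<forall>\<^sub>F n in sequentially. bmoa_dist (G n) l < \<epsilon>"
      using lim by (auto simp: BMOA.limitin_metric G_def eventually_conj_iff)
    have GB: "G n \<in> BMOA" for n
      using T F by (auto simp: G_def)
    have hols: "G n holomorphic_on \<bbbD>" "l holomorphic_on \<bbbD>" for n
      using GB l by (auto simp: BMOA_def)
    have dist: "enn2real (bmoa_seminorm (\<lambda>z. G n z - l z)) \<le> bmoa_dist (G n) l" for n
      by (simp add: bmoa_dist_def bmoa_norm_def)
    have dist_lim: "(\<lambda>n. bmoa_dist (G n) l) \<longlonglongrightarrow> 0"
      unfolding tendsto_iff using lim by (simp add: BMOA.nonneg)
    have "l z = l 0" if z: "z \<in> \<bbbD>" for z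
    proof -
      have "(\<lambda>n. (G n z - l z) - (G n 0 - l 0)) \<longlonglongrightarrow> 0"
      proof (rule Lim_null_comparison)
        show "\<forall>\<^sub>F n in sequentially. cmod ((G n z - l z) - (G n 0 - l 0))
            \<le> bmoa_dist (G n) l / sqrt (1 - cmod z)"
        proof (intro always_eventually allI)
          fix n
          have "(cmod ((G n z - l z) - (G n 0 - l 0)))\<^sup>2 * (1 - cmod z) \<le> (bmoa_dist (G n) l)\<^sup>2"
          proof (rule norm_diff_le_bmoa_seminorm[of "\<lambda>z. G n z - l z"])
            show "bmoa_seminorm (\<lambda>z. G n z - l z) \<le> ennreal (bmoa_dist (G n) l)"
              using bmoa_seminorm_diff_finite[OF GB l, of n] dist[of n]
              by (metis ennreal_enn2real ennreal_leI infinity_ennreal_def)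
          qed (use z hols in \<open>auto intro!: holomorphic_intros simp: BMOA.nonneg\<close>)
          then have "cmod ((G n z - l z) - (G n 0 - l 0)) \<le> sqrt ((bmoa_dist (G n) l)\<^sup>2 / (1 - cmod z))"
            using z by (intro real_le_rsqrt) (simp add: pos_le_divide_eq)
          then show "cmod ((G n z - l z) - (G n 0 - l 0)) \<le> bmoa_dist (G n) l / sqrt (1 - cmod z)"
            by (simp add: real_sqrt_divide BMOA.nonneg)
        qed
        show "(\<lambda>n. bmoa_dist (G n) l / sqrt (1 - cmod z)) \<longlonglongrightarrow> 0"
          using dist_lim by (rule tendsto_divide_zero)
      qed
      moreover have "(\<lambda>n. G n z - G n 0) \<longlonglongrightarrow> 0"
      proof -
        have *: "(\<lambda>n. \<sigma> (a (r n)) w - a (r n)) \<longlonglongrightarrow> 0" if w: "w \<in> \<bbbD>" for w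
        proof (rule Lim_null_comparison)
          show "\<forall>\<^sub>F n in sequentially. cmod (\<sigma> (a (r n)) w - a (r n)) \<le> (1 - (cmod (a (r n)))\<^sup>2) / (1 - cmod w)"
            by (intro always_eventually allI norm_disc_aut_diff_le aD w)
          have "(\<lambda>n. cmod (a (r n))) \<longlonglongrightarrow> 1"
            using LIMSEQ_subseq_LIMSEQ[OF a_lim r] by (simp add: o_def)
          then have "(\<lambda>n. (1 - (cmod (a (r n)))\<^sup>2) / (1 - cmod w)) \<longlonglongrightarrow> (1 - 1\<^sup>2) / (1 - cmod w)"
            using w by (intro tendsto_intros) auto
          then show "(\<lambda>n. (1 - (cmod (a (r n)))\<^sup>2) / (1 - cmod w)) \<longlonglongrightarrow> 0" by simp
        qed
        have "\<phi> z \<in> \<bbbD>" "\<phi> 0 \<in> \<bbbD>" using \<phi>(2) z by (auto simp: image_subset_iff)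
        from tendsto_mult_right_zero[OF tendsto_diff[OF this[THEN *], simplified], of "of_real (1 / 4)"] this
        show ?thesis
          using z by (simp add: G_def F_def composition_op_def algebra_simps)
      qed
      ultimately have "(\<lambda>n. ((G n z - l z) - (G n 0 - l 0)) - (G n z - G n 0)) \<longlonglongrightarrow> 0 - 0"
        by (intro tendsto_diff)
      then have "(\<lambda>n::nat. l 0 - l z) \<longlonglongrightarrow> 0"
        by (simp add: algebra_simps)
      then show ?thesis
        by (simp add: LIMSEQ_const_iff)
    qed note l_const = this
    have sem_G: "bmoa_seminorm (\<lambda>z. G n z - l z) = ennreal (1 / 4) * bmoa_seminorm (\<sigma> (a (r n)) \<circ> \<phi>)" for n
    proof -
      have "bmoa_seminorm (\<lambda>z. G n z - l z) = bmoa_seminorm (\<lambda>z. of_real (1 / 4) * (\<sigma> (a (r n)) \<circ> \<phi>) z - l 0)"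
      proof (rule bmoa_seminorm_cong)
        fix z assume z: "z \<in> \<bbbD>"
        then have "\<phi> z \<in> \<bbbD>" using \<phi>(2) by (auto simp: image_subset_iff)
        with z show "G n z - l z = of_real (1 / 4) * (\<sigma> (a (r n)) \<circ> \<phi>) z - l 0"
          unfolding l_const[OF z] by (simp add: G_def F_def composition_op_def)
      qed
      also have "\<dots> = bmoa_seminorm (\<lambda>z. of_real (1 / 4) * (\<sigma> (a (r n)) \<circ> \<phi>) z)"
        by (simp add: bmoa_seminorm_def)
      also have "\<dots> = ennreal (1 / 4) * bmoa_seminorm (\<sigma> (a (r n)) \<circ> \<phi>)"
        by (subst bmoa_seminorm_cmult) (simp add: norm_divide)
      finally show ?thesis .
    qed
    obtain c where c: "c > 0" "ennreal c \<le> ennreal (1 / 4) * e"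
      using \<open>0 < e\<close> by (cases e) (auto simp: ennreal_mult'[symmetric] ennreal_mult_top intro: that[of 1] that[of "_ / 4"])
    obtain n where n: "bmoa_dist (G n) l < c"
      using lim[OF c(1)] by (auto simp: eventually_sequentially)
    have "ennreal c \<le> bmoa_seminorm (\<lambda>z. G n z - l z)"
      using c(2) mult_left_mono[OF a(3)[of "r n"], of "ennreal (1 / 4)"] by (simp add: sem_G)
    then have "c \<le> enn2real (bmoa_seminorm (\<lambda>z. G n z - l z))"
      using enn2real_mono[of "ennreal c"] bmoa_seminorm_diff_finite[OF GB l, of n] c(1) by fastforce
    with dist[of n] n show False by simp
  qed
qed simp

theorem corollary5:
  fixes \<phi> :: "complex \<Rightarrow> complex"
  assumes "\<phi> holomorphic_on \<bbbD>" and "\<phi> ` \<bbbD> \<subseteq> \<bbbD>"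
  shows "compact_on_BMOA (composition_op \<phi>) \<longleftrightarrow>
    ((\<lambda>a. bmoa_seminorm (\<sigma> a \<circ> \<phi>)) \<longlongrightarrow> 0) (filtercomap cmod (at_left 1))"
  using bmoa_seminorm_vanishes_if_compact[OF assms] compact_if_bmoa_seminorm_vanishes[OF assms]
  by (rule iffI)

end
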